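(* Let $S$ be a cancellative semigroup and let $F$ be a field. The semigroup algebra $FS$ is centrally essential if and only if $FS$ has the classical right ring of fractions and this classical right ring of fractions is a centrally essential ring.
   Context: A semigroup is a non-empty set with an associative operation (no identity element is required). Rings are associative and not necessarily unital. A ring $R$ with center $Z(R)$ is called centrally essential if either $R$ is commutative, or for every non-central element $a\in R$ there exist non-zero central elements $x,y\in Z(R)$ with $ax=y$. For a field $F$ and a semigroup $S$, $FS$ denotes the semigroup algebra: the $F$-vector space with basis $S$ and multiplication extending that of $S$ bilinearly. A semigroup $S$ is cancellative if for all $a,b,c\in S$, $ca=cb$ implies $a=b$, and $ac=bc$ implies $a=b$. A non-zero-divisor of a ring $R$ is an element $r\in R$ such that $rx=0$ implies $x=0$ and $xr=0$ implies $x=0$, for $x\in R$. A ring $R$ has the classical right ring of fractions if and only if for any $a,b\in R$ with $b$ a non-zero-divisor there exist $c,d\in R$ with $d$ a non-zero-divisor such that $bc=ad$. In this case the classical right ring of fractions is the unital ring $Q\supseteq R$ in which every non-zero-divisor of $R$ is invertible and every element has the form $ab^{-1}$ with $a,b\in R$ and $b$ a non-zero-divisor of $R$. *)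

theory Defs
  imports "HOL-Library.Poly_Mapping" "HOL-Algebra.Ring"
begin

section \<open>Not necessarily unital rings\<close>

text \<open>
  Rings are records of HOL-Algebra.  The locale \<^locale>\<open>ring\<close> demands an identity, so
  rings without identity get a locale of their own; there the record field \<open>one\<close> carries
  no information, and no definition below that is applied to a possibly non-unital ring
  looks at it.
\<close>

locale nonunital_ring = abelian_group R for R (structure) +
  assumes m_closed: "\<lbrakk>x \<in> carrier R; y \<in> carrier R\<rbrakk> \<Longrightarrow> x \<otimes> y \<in> carrier R"
    and m_assoc: "\<lbrakk>x \<in> carrier R; y \<in> carrier R; z \<in> carrier R\<rbrakk>
      \<Longrightarrow> (x \<otimes> y) \<otimes> z = x \<otimes> (y \<otimes> z)"
    and l_distr: "\<lbrakk>x \<in> carrier R; y \<in> carrier R; z \<in> carrier R\<rbrakk>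
      \<Longrightarrow> (x \<oplus> y) \<otimes> z = x \<otimes> z \<oplus> y \<otimes> z"
    and r_distr: "\<lbrakk>x \<in> carrier R; y \<in> carrier R; z \<in> carrier R\<rbrakk>
      \<Longrightarrow> z \<otimes> (x \<oplus> y) = z \<otimes> x \<oplus> z \<otimes> y"

definition ring_center :: "('a, 'm) ring_scheme \<Rightarrow> 'a set" where
  "ring_center R = {z \<in> carrier R. \<forall>r \<in> carrier R. z \<otimes>\<^bsub>R\<^esub> r = r \<otimes>\<^bsub>R\<^esub> z}"

definition centrally_essential :: "('a, 'm) ring_scheme \<Rightarrow> bool" where
  "centrally_essential R \<longleftrightarrow>
    (\<forall>a \<in> carrier R. \<forall>b \<in> carrier R. a \<otimes>\<^bsub>R\<^esub> b = b \<otimes>\<^bsub>R\<^esub> a) \<or>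
    (\<forall>a \<in> carrier R - ring_center R.
      \<exists>x \<in> ring_center R - {\<zero>\<^bsub>R\<^esub>}. \<exists>y \<in> ring_center R - {\<zero>\<^bsub>R\<^esub>}. a \<otimes>\<^bsub>R\<^esub> x = y)"

definition non_zero_divisors :: "('a, 'm) ring_scheme \<Rightarrow> 'a set" where
  "non_zero_divisors R = {r \<in> carrier R. \<forall>x \<in> carrier R.
    (r \<otimes>\<^bsub>R\<^esub> x = \<zero>\<^bsub>R\<^esub> \<longrightarrow> x = \<zero>\<^bsub>R\<^esub>) \<and> (x \<otimes>\<^bsub>R\<^esub> r = \<zero>\<^bsub>R\<^esub> \<longrightarrow> x = \<zero>\<^bsub>R\<^esub>)}"

section \<open>Classical right rings of fractions\<close>

definition has_classical_right_fractions :: "('a, 'm) ring_scheme \<Rightarrow> bool" where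
  "has_classical_right_fractions R \<longleftrightarrow>
    (\<forall>a \<in> carrier R. \<forall>b \<in> non_zero_divisors R.
      \<exists>c \<in> carrier R. \<exists>d \<in> non_zero_divisors R. b \<otimes>\<^bsub>R\<^esub> c = a \<otimes>\<^bsub>R\<^esub> d)"

text \<open>
  The inclusion of \<open>R\<close> in its ring of fractions \<open>Q\<close> is an injective homomorphism \<open>\<iota>\<close> of
  additive groups and multiplicative semigroups.  The library's \<open>ring_hom\<close> is not used,
  because it refers to the (meaningless) field \<open>one\<close> of \<open>R\<close>.
\<close>

definition is_classical_right_ring_of_fractions ::
  "('a, 'm) ring_scheme \<Rightarrow> ('q, 'n) ring_scheme \<Rightarrow> ('a \<Rightarrow> 'q) \<Rightarrow> bool" where
  "is_classical_right_ring_of_fractions R Q \<iota> \<longleftrightarrow>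
    ring Q \<and>
    \<iota> ` carrier R \<subseteq> carrier Q \<and> inj_on \<iota> (carrier R) \<and>
    (\<forall>x \<in> carrier R. \<forall>y \<in> carrier R. \<iota> (x \<oplus>\<^bsub>R\<^esub> y) = \<iota> x \<oplus>\<^bsub>Q\<^esub> \<iota> y) \<and>
    (\<forall>x \<in> carrier R. \<forall>y \<in> carrier R. \<iota> (x \<otimes>\<^bsub>R\<^esub> y) = \<iota> x \<otimes>\<^bsub>Q\<^esub> \<iota> y) \<and>
    (\<forall>b \<in> non_zero_divisors R. \<iota> b \<in> Units Q) \<and>
    (\<forall>q \<in> carrier Q. \<exists>a \<in> carrier R. \<exists>b \<in> non_zero_divisors R.
      q = \<iota> a \<otimes>\<^bsub>Q\<^esub> inv\<^bsub>Q\<^esub> (\<iota> b))"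

text \<open>
  A fraction \<open>q\<close> is determined by the set of all pairs \<open>(a, b)\<close> with \<open>q = a b\<^sup>-\<^sup>1\<close>.  Hence
  every ring of fractions of a ring with elements of type \<open>'a\<close> is isomorphic to one with
  elements of the following type, and quantifying over rings on this type loses nothing.
\<close>

type_synonym 'a fraction = "('a \<times> 'a) set"

section \<open>Semigroup algebras\<close>

text \<open>
  The library's product on \<^typ>\<open>'s \<Rightarrow>\<^sub>0 'f\<close> needs an additively written monoid \<open>'s\<close>, whereas
  the semigroup here is multiplicative and need not have an identity.
\<close>

definition convolution ::
  "('s::semigroup_mult \<Rightarrow>\<^sub>0 'f::field) \<Rightarrow> ('s \<Rightarrow>\<^sub>0 'f) \<Rightarrow> ('s \<Rightarrow>\<^sub>0 'f)" where
  "convolution f g = (\<Sum>s \<in> Poly_Mapping.keys f. \<Sum>t \<in> Poly_Mapping.keys g.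
    Poly_Mapping.single (s * t) (Poly_Mapping.lookup f s * Poly_Mapping.lookup g t))"

definition semigroup_algebra :: "('s::semigroup_mult \<Rightarrow>\<^sub>0 'f::field) ring" where
  "semigroup_algebra =
    \<lparr>carrier = UNIV, mult = convolution, one = undefined, zero = 0, add = (+)\<rparr>"

lemma convolution_superset:
  assumes "finite A" "finite B" "Poly_Mapping.keys f \<subseteq> A" "Poly_Mapping.keys g \<subseteq> B"
  shows "convolution f g = (\<Sum>s \<in> A. \<Sum>t \<in> B.
    Poly_Mapping.single (s * t) (Poly_Mapping.lookup f s * Poly_Mapping.lookup g t))"
proof -
  have "convolution f g = (\<Sum>s \<in> Poly_Mapping.keys f. \<Sum>t \<in> B.
      Poly_Mapping.single (s * t) (Poly_Mapping.lookup f s * Poly_Mapping.lookup g t))"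
    unfolding convolution_def using assms
    by (intro sum.cong refl sum.mono_neutral_left) (auto simp: in_keys_iff)
  also have "\<dots> = (\<Sum>s \<in> A. \<Sum>t \<in> B.
      Poly_Mapping.single (s * t) (Poly_Mapping.lookup f s * Poly_Mapping.lookup g t))"
    using assms
    by (intro sum.mono_neutral_left) (auto simp: in_keys_iff intro!: sum.neutral)
  finally show ?thesis .
qed

lemma convolution_single:
  "convolution (Poly_Mapping.single s a) (Poly_Mapping.single t b) =
    Poly_Mapping.single (s * t) (a * b)"
  by (subst convolution_superset[of "{s}" "{t}"]) (auto simp: lookup_single)

lemma convolution_add_left: "convolution (f + g) h = convolution f h + convolution g h"
proof -
  let ?A = "Poly_Mapping.keys f \<union> Poly_Mapping.keys g" and ?B = "Poly_Mapping.keys h"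
  have "Poly_Mapping.keys (f + g) \<subseteq> ?A"
    by (rule Poly_Mapping.keys_add)
  then show ?thesis
    by (simp add: convolution_superset[of ?A ?B] lookup_add distrib_right single_add sum.distrib)
qed

lemma convolution_add_right: "convolution h (f + g) = convolution h f + convolution h g"
proof -
  let ?A = "Poly_Mapping.keys f \<union> Poly_Mapping.keys g" and ?B = "Poly_Mapping.keys h"
  have "Poly_Mapping.keys (f + g) \<subseteq> ?A"
    by (rule Poly_Mapping.keys_add)
  then show ?thesis
    by (simp add: convolution_superset[of ?B ?A] lookup_add distrib_left single_add sum.distrib)
qed

lemma convolution_zero [simp]: "convolution 0 f = 0" "convolution f 0 = 0"
  by (simp_all add: convolution_def)

lemma convolution_sum_left: "convolution (\<Sum>i \<in> I. f i) h = (\<Sum>i \<in> I. convolution (f i) h)"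
  by (induction I rule: infinite_finite_induct) (simp_all add: convolution_add_left)

lemma convolution_sum_right: "convolution h (\<Sum>i \<in> I. f i) = (\<Sum>i \<in> I. convolution h (f i))"
  by (induction I rule: infinite_finite_induct) (simp_all add: convolution_add_right)

lemma poly_mapping_sum_single:
  "f = (\<Sum>s \<in> Poly_Mapping.keys f. Poly_Mapping.single s (Poly_Mapping.lookup f s))"
  by (rule poly_mapping_eqI)
    (simp add: lookup_sum lookup_single when_def in_keys_iff)

lemma convolution_assoc: "convolution (convolution f g) h = convolution f (convolution g h)"
  apply (subst (1 2) poly_mapping_sum_single[of f])
  apply (subst (1 2) poly_mapping_sum_single[of g])
  apply (subst (1 2) poly_mapping_sum_single[of h])
  by (simp only: convolution_sum_left convolution_sum_right convolution_single mult.assoc)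

lemma nonunital_ring_semigroup_algebra:
  "nonunital_ring (semigroup_algebra :: ('s::semigroup_mult \<Rightarrow>\<^sub>0 'f::field) ring)"
proof -
  have "abelian_group (semigroup_algebra :: ('s \<Rightarrow>\<^sub>0 'f) ring)"
    by (rule abelian_groupI) (auto simp: semigroup_algebra_def add_ac intro: exI[of _ "- _"])
  then show ?thesis
    by (intro nonunital_ring.intro nonunital_ring_axioms.intro)
      (simp_all add: semigroup_algebra_def convolution_assoc
        convolution_add_left convolution_add_right)
qed

end

theory Submission
  imports Defs HOL.Vector_Spaces "HOL-Library.FuncSet" "HOL-Library.Multiset"
    "HOL-Computational_Algebra.Primes"
begin

text \<open>
  Call the semigroup algebra \<open>R\<close>.  If \<open>R\<close> or its ring of fractions \<open>Q\<close> is centrally essential, then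
  for finitely many \<open>a\<^sub>i \<in> R\<close>, not all zero, some central \<open>y \<in> Q\<close> makes all \<open>a\<^sub>i y\<close> central and not
  all zero; a numerator \<open>c\<close> of \<open>y\<close> then satisfies \<open>[a\<^sub>i, r] r' c = 0\<close> for all \<open>r\<close> and \<open>r'\<close>, while
  some \<open>a\<^sub>i c \<noteq> 0\<close>.  Everything follows from this property of \<open>R\<close>.

  Applied to \<open>g \<in> S\<close> it says that commutators with \<open>g\<close> permute the finite support of \<open>c\<close>.  By
  pigeonhole a power of \<open>g\<close> is central, and \<open>g\<close> has finitely many conjugates.  A Nakayama argument on
  the span of finitely many elements of \<open>S\<close> shows that each \<open>x \<mapsto> b x - x b\<close> is locally nilpotent on
  \<open>R\<close>, so in characteristic \<open>p\<close> a power \<open>b\<^bsup>p^k\<^esup>\<close> commutes with any given element; in characteristic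
  zero averaging over conjugates shows that \<open>S\<close> is commutative.  Hence, up to a central factor from
  \<open>S\<close>, a regular \<open>b\<close> has finitely many conjugates, suitable powers of which commute, and their
  product is a central regular multiple \<open>b c\<close> of \<open>b\<close>.  So \<open>Q\<close> arises from \<open>R\<close> by inverting central
  regular elements only, and central multiples pass back and forth between \<open>R\<close> and \<open>Q\<close>.
\<close>

section \<open>Powers, commutators and conjugates\<close>

text \<open>Left and right multiplication by \<open>b\<close> are commuting operators, so this is
  the binomial theorem for their difference, proved with Pascal's rule.\<close>

lemma funpow_commutator:
  fixes b x :: "'a::ring_1"
  shows "((\<lambda>x. b * x - x * b) ^^ n) x =
    (\<Sum>i\<le>n. of_int ((- 1) ^ i * int (n choose i)) * (b ^ (n - i) * x * b ^ i))"
proof (induction n)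
  case (Suc n)
  define c where "c n i = (- 1) ^ i * int (n choose i)" for n i
  have pull: "y * (of_int k * z) = of_int k * (y * z)" for y z :: 'a and k
    by (metis mult.assoc mult_of_int_commute)
  have Pascal: "c (Suc n) (Suc i) = c n (Suc i) - c n i" for i
    by (simp add: c_def algebra_simps)
  have l: "b * (\<Sum>i\<le>n. of_int (c n i) * (b ^ (n - i) * x * b ^ i)) =
      (\<Sum>i\<le>n. of_int (c n i) * (b ^ (Suc n - i) * x * b ^ i))"
    unfolding sum_distrib_left pull
    by (intro sum.cong refl) (simp add: Suc_diff_le mult.assoc)
  have r: "(\<Sum>i\<le>n. of_int (c n i) * (b ^ (n - i) * x * b ^ i)) * b =
      (\<Sum>i\<le>n. of_int (c n i) * (b ^ (n - i) * x * b ^ Suc i))"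
    unfolding sum_distrib_right
    by (intro sum.cong refl) (simp only: mult.assoc power_Suc2)
  \<comment> \<open>The term added at \<open>i = Suc n\<close> vanishes with
    \<open>n choose Suc n\<close>; with it the index shift lines this sum up with the second
    one.\<close>
  have "(\<Sum>i\<le>n. of_int (c n i) * (b ^ (Suc n - i) * x * b ^ i)) =
      (\<Sum>i\<le>Suc n. of_int (c n i) * (b ^ (Suc n - i) * x * b ^ i))"
    by (simp add: c_def binomial_eq_0)
  also have "\<dots> = b ^ Suc n * x +
      (\<Sum>i\<le>n. of_int (c n (Suc i)) * (b ^ (n - i) * x * b ^ Suc i))"
    by (subst sum.atMost_Suc_shift) (simp add: c_def binomial_eq_0)
  finally have "((\<lambda>x. b * x - x * b) ^^ Suc n) x = b ^ Suc n * x +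
      (\<Sum>i\<le>n. of_int (c (Suc n) (Suc i)) * (b ^ (n - i) * x * b ^ Suc i))"
    using Suc.IH l r unfolding c_def[symmetric]
    by (simp only: funpow.simps o_apply Pascal of_int_diff left_diff_distrib sum_subtractf
        add_diff_eq)
  also have "\<dots> = (\<Sum>i\<le>Suc n. of_int (c (Suc n) i) * (b ^ (Suc n - i) * x * b ^ i))"
    by (subst sum.atMost_Suc_shift) (simp add: c_def)
  finally show ?case unfolding c_def .
qed simp

text \<open>The inner binomial coefficients are divisible by \<open>p\<close>, and the last sign is
  \<open>- 1\<close> also for \<open>p = 2\<close>, where \<open>1 = - 1\<close>.\<close>

lemma funpow_commutator_prime:
  fixes b x :: "'a::ring_1"
  assumes "prime p" and p0: "of_nat p = (0::'a)"
  shows "((\<lambda>x. b * x - x * b) ^^ p) x = b ^ p * x - x * b ^ p"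
proof -
  have p: "p > 1"
    using assms(1) by (rule prime_gt_1_nat)
  have z: "of_nat (p choose i) = (0::'a)" if "0 < i" "i < p" for i
  proof -
    have "p dvd p choose i"
      using assms(1) that by (intro dvd_choose_prime) auto
    then show ?thesis
      using p0 by (auto elim!: dvdE)
  qed
  have sgn: "(- 1) ^ p = (- 1 :: 'a)"
  proof (cases "p = 2")
    case True
    then have "(1::'a) + 1 = 0" using p0 by simp
    then show ?thesis using True by (simp add: eq_neg_iff_add_eq_0)
  next
    case False
    then show ?thesis
      using assms(1) prime_odd_nat[of p] prime_ge_2_nat[of p] by simp
  qed
  have "((\<lambda>x. b * x - x * b) ^^ p) x =
      (\<Sum>i\<in>{0, p}. of_int ((- 1) ^ i * int (p choose i)) * (b ^ (p - i) * x * b ^ i))"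
    unfolding funpow_commutator
    by (intro sum.mono_neutral_right) (use z in auto)
  then show ?thesis
    using p sgn by simp
qed

text \<open>Iterating the prime case turns nilpotency of the commutator operator of \<open>b\<close>
  at \<open>x\<close> into commutation of \<open>x\<close> with a power of \<open>b\<close>.\<close>

lemma funpow_commutator_prime_power:
  fixes b x :: "'a::ring_1"
  assumes "prime p" "of_nat p = (0::'a)"
  shows "((\<lambda>x. b * x - x * b) ^^ (p ^ k)) x = b ^ (p ^ k) * x - x * b ^ (p ^ k)"
proof (induction k arbitrary: x)
  case (Suc k)
  have "((\<lambda>x. b * x - x * b) ^^ (p ^ Suc k)) = (((\<lambda>x. b * x - x * b) ^^ (p ^ k)) ^^ p)"
    by (simp add: funpow_mult mult.commute)
  also have "(\<lambda>x. b * x - x * b) ^^ (p ^ k) = (\<lambda>x. b ^ (p ^ k) * x - x * b ^ (p ^ k))"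
    using Suc.IH by blast
  finally show ?case
    by (simp only: funpow_commutator_prime[OF assms] power_Suc2 power_mult)
qed simp

lemma prod_list_permute:
  fixes xs ys :: "'a::monoid_mult list"
  assumes "\<And>x y. x \<in> set xs \<Longrightarrow> y \<in> set xs \<Longrightarrow> x * y = y * x" and "mset xs = mset ys"
  shows "prod_list xs = prod_list ys"
proof -
  have "fold (*) (rev xs) = fold (*) (rev ys)"
    using assms by (intro fold_multiset_equiv) (auto simp: fun_eq_iff simp flip: mult.assoc)
  then show ?thesis
    by (simp add: prod_list.eq_foldr foldr_conv_fold)
qed

lemma uniform_commuting_exponent:
  fixes B :: "'a::monoid_mult set"
  assumes "finite B" "\<And>x y. x \<in> B \<Longrightarrow> y \<in> B \<Longrightarrow> \<exists>q>0. x ^ q * y = y * x ^ q"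
  obtains q where "q \<ge> 2" "\<And>x y. x \<in> B \<Longrightarrow> y \<in> B \<Longrightarrow> x ^ q * y = y * x ^ q"
proof -
  have "\<forall>x\<in>B. \<forall>y\<in>B. \<exists>q. 0 < q \<and> x ^ q * y = y * x ^ q"
    using assms(2) by simp
  then obtain g where g: "g x y > 0" "x ^ g x y * y = y * x ^ g x y" if "x \<in> B" "y \<in> B" for x y
    by metis
  define f where "f = (\<lambda>(x, y). g x y)"
  have f: "f (x, y) > 0" "x ^ f (x, y) * y = y * x ^ f (x, y)" if "x \<in> B" "y \<in> B" for x y
    using g[OF that] by (simp_all add: f_def)
  \<comment> \<open>The product is a multiple of the exponent of every pair. The factor 2 keeps
    \<open>q - 1\<close> positive, so that a factor \<open>b\<close> remains when one is split off
    from \<open>b ^ q\<close>.\<close>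
  define q where "q = 2 * prod f (B \<times> B)"
  have "prod f (B \<times> B) > 0"
    using f by (auto intro!: prod_pos)
  then have "q \<ge> 2" by (simp add: q_def)
  moreover have "x ^ q * y = y * x ^ q" if "x \<in> B" "y \<in> B" for x y
  proof -
    have "f (x, y) dvd q"
      unfolding q_def using that assms(1) by (intro dvd_mult dvd_prodI) auto
    then obtain k where k: "q = f (x, y) * k" ..
    show ?thesis
      unfolding k power_mult using f(2)[OF that] by (rule power_commuting_commutes)
  qed
  ultimately show thesis using that by blast
qed

text \<open>A noncommutative norm: the product of suitable powers of the elements of \<open>B\<close>, in any
  order, commutes with every \<open>s\<close> whose conjugation permutes \<open>B\<close>.\<close>

lemma conjugation_invariant_multiple:
  fixes B :: "'a::monoid_mult set"
  assumes "finite B" "b \<in> B"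
    and comm: "\<And>x y. x \<in> B \<Longrightarrow> y \<in> B \<Longrightarrow> \<exists>q>0. x ^ q * y = y * x ^ q"
  obtains xs where "xs \<noteq> []" "set xs \<subseteq> B"
    and "\<forall>s. (\<forall>x\<in>B. \<exists>y\<in>B. x * s = s * y) \<and> inj_on (\<lambda>x. x * s) B \<longrightarrow>
      b * prod_list xs * s = s * (b * prod_list xs)"
proof -
  obtain q where q: "q \<ge> 2" "\<And>x y. x \<in> B \<Longrightarrow> y \<in> B \<Longrightarrow> x ^ q * y = y * x ^ q"
    using uniform_commuting_exponent[OF assms(1) comm] by metis
  obtain L where L: "set L = B - {b}" "distinct L"
    using assms(1) finite_distinct_list by blast
  define P where "P ys = prod_list (map (\<lambda>x. x ^ q) ys)" for ys :: "'a list"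
  \<comment> \<open>One \<open>b\<close> is left out, so that \<open>b * prod_list xs\<close> is the
    product of the \<open>q\<close>-th powers of all elements of \<open>B\<close>.\<close>
  define xs where "xs = replicate (q - 1) b @ concat (map (replicate q) L)"
  have prod_repl: "prod_list (replicate n x) = x ^ n" for n and x :: 'a
    by (induction n) auto
  have prod_concat: "prod_list (concat (map (replicate q) ys)) = P ys" for ys :: "'a list"
    by (induction ys) (auto simp: P_def prod_repl)
  have d: "b * prod_list xs = P (b # L)"
    using q(1) by (simp add: xs_def prod_repl prod_concat P_def flip: mult.assoc power_Suc)
  show thesis
  proof (rule that, safe)
    show "x \<in> B" if "x \<in> set xs" for x
      using that q(1) L assms(2) by (auto simp: xs_def)
    show False if "xs = []"
      using that q(1) by (simp add: xs_def)
    fix s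
    assume s: "\<forall>x\<in>B. \<exists>y\<in>B. x * s = s * y" and inj: "inj_on (\<lambda>x. x * s) B"
    \<comment> \<open>\<open>f\<close> is conjugation by \<open>s\<close>, written without an
      inverse. As an injective self-map of a finite set it permutes \<open>B\<close>.\<close>
    obtain f where f: "f x \<in> B" "x * s = s * f x" if "x \<in> B" for x
      using s by metis
    have "inj_on f B"
    proof (rule inj_onI)
      fix x y assume "x \<in> B" "y \<in> B" "f x = f y"
      then have "x * s = y * s" using f(2) by simp
      then show "x = y" by (rule inj_onD[OF inj _ \<open>x \<in> B\<close> \<open>y \<in> B\<close>])
    qed
    moreover have "f ` B = B"
      using f(1) \<open>inj_on f B\<close> assms(1) by (intro endo_inj_surj) auto
    moreover have "mset (b # L) = mset_set B"
      using mset_set_set[of "b # L"] L assms(2) by (simp add: insert_absorb)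
    ultimately have img: "mset (map f (b # L)) = mset (b # L)"
      by (simp only: mset_map image_mset_mset_set)
    have pow: "x ^ n * s = s * f x ^ n" if "x \<in> B" for x n
    proof (induction n)
      case (Suc n)
      have "x ^ Suc n * s = x * (x ^ n * s)"
        by (simp add: mult.assoc)
      also have "\<dots> = s * (f x * f x ^ n)"
        by (simp only: Suc.IH f(2)[OF that] flip: mult.assoc)
      finally show ?case by simp
    qed simp
    have "P ys * s = s * P (map f ys)" if "set ys \<subseteq> B" for ys
      using that
    proof (induction ys)
      case (Cons y ys)
      then have "P (y # ys) * s = y ^ q * s * P (map f ys)"
        by (simp add: P_def mult.assoc)
      also have "\<dots> = s * P (map f (y # ys))"
        using Cons.prems pow[of y q] by (simp add: P_def mult.assoc)
      finally show ?case .
    qed (simp add: P_def)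
    moreover have "P (map f (b # L)) = P (b # L)"
      unfolding P_def
    \<comment> \<open>Conjugation only rearranges the factors, and \<open>q\<close>-th powers of
      elements of \<open>B\<close> commute with one another.\<close>
    proof (rule prod_list_permute)
      show "mset (map (\<lambda>x. x ^ q) (map f (b # L))) = mset (map (\<lambda>x. x ^ q) (b # L))"
        using img by (simp only: mset_map)
      fix x y assume "x \<in> set (map (\<lambda>x. x ^ q) (map f (b # L)))"
        "y \<in> set (map (\<lambda>x. x ^ q) (map f (b # L)))"
      then obtain x' y' where "x' \<in> B" "y' \<in> B" "x = x' ^ q" "y = y' ^ q"
        using L f(1) assms(2) by auto
      then show "x * y = y * x"
        using q(2) by (metis power_commuting_commutes)
    qed
    ultimately show "b * prod_list xs * s = s * (b * prod_list xs)"
      using L assms(2) d by auto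
  qed
qed

section \<open>The semigroup algebra with an adjoined identity\<close>

text \<open>A new identity is adjoined even if the semigroup has one, so that the old elements form
  an ideal. The monoid is written additively below because the product on
  \<open>'s unitization \<Rightarrow>\<^sub>0 'f\<close> is convolution over an additive
  monoid.\<close>

datatype 's unitization = One | El 's

instantiation unitization :: (semigroup_mult) monoid_add
begin

definition zero_unitization :: "'a unitization" where
  "zero_unitization = One"

fun plus_unitization :: "'a unitization \<Rightarrow> 'a unitization \<Rightarrow> 'a unitization" where
  "plus_unitization One y = y"
| "plus_unitization x One = x"
| "plus_unitization (El s) (El t) = El (s * t)"

instance
proof
  fix a b c :: "'a unitization"
  show "a + b + c = a + (b + c)"
    by (cases a; cases b; cases c) (simp_all add: mult.assoc)
  show "0 + a = a" "a + 0 = a"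
    by (cases a; simp add: zero_unitization_def)+
qed

end

lemma add_eq_One_iff [simp]:
  "x + y = One \<longleftrightarrow> x = One \<and> y = One" "One = x + y \<longleftrightarrow> x = One \<and> y = One"
  by (cases x; cases y; simp)+

type_synonym ('s, 'f) unital_algebra = "'s unitization \<Rightarrow>\<^sub>0 'f"

definition gen :: "'s \<Rightarrow> ('s::semigroup_mult, 'f::field) unital_algebra" where
  "gen s = Poly_Mapping.single (El s) 1"

definition scale :: "'f \<Rightarrow> ('s, 'f) unital_algebra \<Rightarrow> ('s::semigroup_mult, 'f::field) unital_algebra" where
  "scale c x = Poly_Mapping.single 0 c * x"

definition supp :: "('s::semigroup_mult, 'f::field) unital_algebra \<Rightarrow> 's set" where
  "supp x = {s. Poly_Mapping.lookup x (El s) \<noteq> 0}"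

text \<open>The copy of the semigroup algebra inside its unitization: the kernel of the projection
  to the coefficient of the adjoined identity. It is not the ideal of elements with coefficient sum
  zero.\<close>

definition augmentation :: "('s::semigroup_mult, 'f::field) unital_algebra set" where
  "augmentation = {x. Poly_Mapping.lookup x One = 0}"

abbreviation coeff :: "('s::semigroup_mult, 'f::field) unital_algebra \<Rightarrow> 's \<Rightarrow> 'f" where
  "coeff x s \<equiv> Poly_Mapping.lookup x (El s)"

lemma lookup_scale [simp]: "Poly_Mapping.lookup (scale c x) k = c * Poly_Mapping.lookup x k"
  by (simp add: scale_def flip: mult_map_scale_conv_mult) (simp add: map.rep_eq when_def)

interpretation unital_algebra: vector_space "scale :: 'f::field \<Rightarrow> ('s::semigroup_mult, 'f) unital_algebra \<Rightarrow> _"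
  by unfold_locales (auto intro!: poly_mapping_eqI simp: lookup_add algebra_simps)

lemma mult_scale_left [simp]: "scale c x * y = scale c (x * y)"
  by (simp add: scale_def mult.assoc)

lemma mult_scale_right [simp]: "x * scale c y = scale c (x * y)"
proof -
  have "x * Poly_Mapping.single 0 c = Poly_Mapping.single 0 c * x"
    by (subst (1 2) poly_mapping_sum_single[of x])
      (simp add: sum_distrib_left sum_distrib_right mult_single mult.commute)
  then show ?thesis
    by (simp add: scale_def flip: mult.assoc)
qed

lemma gen_mult: "gen (s * t) = gen s * gen t"
  by (simp add: gen_def mult_single)

lemma coeff_gen [simp]: "coeff (gen s) t = (if s = t then 1 else 0)"
  by (simp add: gen_def lookup_single when_def)

lemma gen_inj [simp]: "(gen s :: ('s::semigroup_mult, 'f::field) unital_algebra) = gen t \<longleftrightarrow> s = t"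
  by (metis coeff_gen zero_neq_one)

lemma finite_supp [simp]: "finite (supp x)"
proof -
  have "El ` supp x \<subseteq> Poly_Mapping.keys x"
    by (auto simp: supp_def in_keys_iff)
  then have "finite (El ` supp x)"
    using finite_keys finite_subset by blast
  then show ?thesis
    by (rule finite_imageD) (simp add: inj_on_def)
qed

lemma in_supp_iff: "s \<in> supp x \<longleftrightarrow> coeff x s \<noteq> 0"
  by (simp add: supp_def)

lemma subspace_augmentation: "unital_algebra.subspace augmentation"
  by (rule unital_algebra.subspaceI) (simp_all add: augmentation_def lookup_add)

lemma gen_in_augmentation [simp]: "gen s \<in> augmentation"
  by (simp add: augmentation_def gen_def lookup_single)

lemma augmentation_mult:
  assumes "x \<in> augmentation"
  shows "x * y \<in> augmentation" "y * x \<in> augmentation"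
  using assms keys_mult[of x y] keys_mult[of y x]
  by (auto simp: augmentation_def simp flip: not_in_keys_iff_lookup_eq_zero)

lemma augmentation_eqI:
  "x \<in> augmentation \<Longrightarrow> y \<in> augmentation \<Longrightarrow> (\<And>s. coeff x s = coeff y s) \<Longrightarrow> x = y"
  by (rule poly_mapping_eqI) (metis (mono_tags) augmentation_def mem_Collect_eq unitization.exhaust)

lemma augmentation_expand:
  assumes "x \<in> augmentation"
  shows "x = (\<Sum>s\<in>supp x. scale (coeff x s) (gen s))"
proof (rule augmentation_eqI[OF assms])
  show "(\<Sum>s\<in>supp x. scale (coeff x s) (gen s)) \<in> augmentation"
    using subspace_augmentation
    by (intro unital_algebra.subspace_sum unital_algebra.subspace_scale) auto
qed (auto simp: lookup_sum if_distrib in_supp_iff cong: if_cong)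

lemma supp_empty_iff: "x \<in> augmentation \<Longrightarrow> supp x = {} \<longleftrightarrow> x = 0"
  using augmentation_expand[of x] by (auto simp: supp_def)

lemma augmentation_commute:
  assumes "x \<in> augmentation" "\<And>s. gen s * y = y * gen s"
  shows "x * y = y * x"
  by (subst (1 2) augmentation_expand[OF assms(1)])
    (simp add: sum_distrib_left sum_distrib_right assms(2))

text \<open>Without an identity powers start at exponent 1: \<open>spower g n\<close> is the power
  of \<open>g\<close> with exponent \<open>n + 1\<close>.\<close>

primrec spower :: "'s::semigroup_mult \<Rightarrow> nat \<Rightarrow> 's" where
  "spower g 0 = g"
| "spower g (Suc n) = g * spower g n"

lemma spower_mult: "spower g m * spower g n = spower g (Suc (m + n))"
  by (induction m) (simp_all add: mult.assoc)

definition central :: "'s::semigroup_mult \<Rightarrow> bool" where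
  "central s \<longleftrightarrow> (\<forall>t. s * t = t * s)"

lemma central_mult: "central s \<Longrightarrow> central t \<Longrightarrow> central (s * t)"
  unfolding central_def by (metis mult.assoc)

lemma gen_central: "central s \<Longrightarrow> x \<in> augmentation \<Longrightarrow> gen s * x = x * gen s"
  by (rule augmentation_commute[symmetric]) (simp_all add: central_def flip: gen_mult)

section \<open>Translations by elements of a cancellative semigroup\<close>

locale cancellative_semigroup =
  fixes S :: "'s::semigroup_mult itself"
  assumes left_cancel: "\<And>a b c :: 's. c * a = c * b \<Longrightarrow> a = b"
    and right_cancel: "\<And>a b c :: 's. a * c = b * c \<Longrightarrow> a = b"
begin

text \<open>Translations of the semigroup are injective by cancellation, so no two terms of
  \<open>x\<close> merge and coefficients are merely relabelled.\<close>

lemma coeff_gen_mult: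
  fixes x :: "('s, 'f::field) unital_algebra"
  assumes "x \<in> augmentation"
  shows "coeff (gen s * x) (s * t) = coeff x t" "coeff (x * gen s) (t * s) = coeff x t"
proof -
  have "s * u = s * t \<longleftrightarrow> u = t" "u * s = t * s \<longleftrightarrow> u = t" for u
    using left_cancel right_cancel by blast+
  then show "coeff (gen s * x) (s * t) = coeff x t" "coeff (x * gen s) (t * s) = coeff x t"
    by (subst augmentation_expand[OF assms],
        simp add: sum_distrib_left sum_distrib_right lookup_sum if_distrib in_supp_iff
          flip: gen_mult cong: if_cong)+
qed

lemma gen_cancel:
  fixes x y :: "('s, 'f::field) unital_algebra"
  assumes "x \<in> augmentation" "y \<in> augmentation"
  shows "gen s * x = gen s * y \<longleftrightarrow> x = y" "x * gen s = y * gen s \<longleftrightarrow> x = y"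
  using coeff_gen_mult assms by (metis augmentation_eqI)+

lemma gen_mult_eq_0:
  fixes x :: "('s, 'f::field) unital_algebra"
  assumes "x \<in> augmentation"
  shows "gen s * x = 0 \<longleftrightarrow> x = 0" "x * gen s = 0 \<longleftrightarrow> x = 0"
  using gen_cancel[OF assms, of 0 s] by (simp_all add: augmentation_def)

lemma supp_gen_mult:
  fixes x :: "('s, 'f::field) unital_algebra"
  assumes "x \<in> augmentation"
  shows "supp (gen s * x) = (*) s ` supp x"
proof
  show "(*) s ` supp x \<subseteq> supp (gen s * x)"
    using coeff_gen_mult(1)[OF assms] by (auto simp: supp_def)
  show "supp (gen s * x) \<subseteq> (*) s ` supp x"
  proof
    fix u
    assume "u \<in> supp (gen s * x)"
    moreover have "coeff (gen s * x) u = (\<Sum>t\<in>supp x. coeff x t * (if s * t = u then 1 else 0))"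
      by (subst augmentation_expand[OF assms])
        (auto simp: sum_distrib_left lookup_sum simp flip: gen_mult)
    ultimately obtain t where "t \<in> supp x" "s * t = u"
      by (force simp: supp_def elim: sum.not_neutral_contains_not_neutral split: if_splits)
    then show "u \<in> (*) s ` supp x" by blast
  qed
qed

end

section \<open>Central powers and finite conjugacy\<close>

text \<open>\<open>c\<close> lies in the right annihilator of the right ideal generated by the
  commutators with \<open>A\<close>. As \<open>r'\<close> ranges over the unital algebra,
  \<open>r' = 1\<close> is included, and a commutator may be separated from \<open>c\<close> by
  further factors.\<close>

definition annihilates_commutators ::
  "('s::semigroup_mult, 'f::field) unital_algebra set \<Rightarrow> ('s, 'f) unital_algebra \<Rightarrow> bool" where
  "annihilates_commutators A c \<longleftrightarrow>
    (\<forall>a\<in>A. \<forall>r\<in>augmentation. \<forall>r'. (a * r - r * a) * r' * c = 0)"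

lemma annihilates_commutatorsD:
  "annihilates_commutators A c \<Longrightarrow> a \<in> A \<Longrightarrow> r \<in> augmentation \<Longrightarrow> a * r * r' * c = r * a * r' * c"
  unfolding annihilates_commutators_def left_diff_distrib right_minus_eq by blast

text \<open>The trace of \<open>annihilates_commutators\<close> on supports. In a group of fractions
  it says that the commutators of \<open>E\<close> with the whole semigroup map \<open>T\<close> and
  all its translates \<open>s T\<close> into themselves; \<open>T\<close> itself is listed
  separately because \<open>s\<close> cannot be an identity.\<close>

definition shuffles :: "'s::semigroup_mult set \<Rightarrow> 's set \<Rightarrow> bool" where
  "shuffles E T \<longleftrightarrow> finite T \<and> T \<noteq> {} \<and>
    (\<forall>g\<in>E. \<forall>h. \<forall>t\<in>T. (\<exists>t'\<in>T. g * h * t = h * g * t') \<and>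
      (\<forall>s. \<exists>t'\<in>T. g * h * s * t = h * g * s * t'))"

context cancellative_semigroup
begin

text \<open>Moving successive powers of \<open>g\<close> past \<open>h\<close> yields elements of
  the finite set \<open>T\<close>. A repetition among them gives a power commuting with
  \<open>h\<close>, with exponent at most \<open>card T\<close>, so one factorial exponent serves
  all \<open>h\<close>.\<close>

lemma shuffles_central_power:
  fixes g :: 's
  assumes "shuffles E T" "g \<in> E"
  shows "\<exists>n. central (spower g n)"
proof -
  have T: "finite T" "T \<noteq> {}"
    and sh: "\<And>h t. t \<in> T \<Longrightarrow> \<exists>t'\<in>T. g * h * t = h * g * t'"
    and shs: "\<And>h s t. t \<in> T \<Longrightarrow> \<exists>t'\<in>T. g * h * s * t = h * g * s * t'"
    using assms by (auto simp: shuffles_def)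
  obtain t0 where "t0 \<in> T" using T by blast
  \<comment> \<open>The factors \<open>g\<close> pass \<open>h\<close> one at a time; the already
    moved power plays the role of \<open>s\<close> in \<open>shs\<close>.\<close>
  have step: "\<exists>t\<in>T. spower g i * h * t0 = h * spower g i * t" for i h
  proof (induction i)
    case 0
    then show ?case using sh[OF \<open>t0 \<in> T\<close>] by simp
  next
    case (Suc i)
    then obtain t where t: "t \<in> T" "spower g i * h * t0 = h * spower g i * t" by blast
    obtain t' where "t' \<in> T" "g * h * spower g i * t = h * g * spower g i * t'"
      using shs[OF t(1)] by blast
    then show ?case
      using t(2) by (auto simp: mult.assoc intro!: bexI[of _ t'])
  qed
  have short: "\<exists>k<card T. spower g k * h = h * spower g k" for h
  proof -
    obtain f where f: "f i \<in> T" "spower g i * h * t0 = h * spower g i * f i" for i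
      using step[of _ h] by metis
    have "\<not> inj_on f {..card T}"
      using card_inj_on_le[of f "{..card T}" T] f(1) T(1) by auto
    then obtain i j where ij: "i < j" "j \<le> card T" "f i = f j"
      by (auto simp: inj_on_def) (metis linorder_neqE_nat)
    \<comment> \<open>The exponents differ by \<open>k + 1\<close>, which is the exponent belonging
      to \<open>spower g k\<close>.\<close>
    obtain k where k: "j = Suc (k + i)"
      using ij(1) by (metis add.commute less_iff_Suc_add)
    have j: "spower g j = spower g k * spower g i"
      by (simp add: k spower_mult)
    have "spower g k * (spower g i * h * t0) = h * spower g j * f j"
      using f(2)[of j] j by (metis mult.assoc)
    also have "\<dots> = h * spower g k * (spower g i * f i)"
      using ij(3) j by (metis mult.assoc)
    finally have "spower g k * h * (spower g i * f i) = h * spower g k * (spower g i * f i)"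
      using f(2)[of i] by (simp add: mult.assoc)
    then have "spower g k * h = h * spower g k"
      by (rule right_cancel)
    then show ?thesis
      using ij k by (intro exI[of _ k]) simp
  qed
  have mult: "spower g (Suc k * m + k) * h = h * spower g (Suc k * m + k)"
    if "spower g k * h = h * spower g k" for k m h
  proof (induction m)
    case (Suc m)
    have "spower g (Suc k * Suc m + k) = spower g k * spower g (Suc k * m + k)"
      by (simp add: spower_mult add_ac)
    then show ?case
      using Suc.IH that by (metis mult.assoc)
  qed (use that in simp)
  \<comment> \<open>By the shift in \<open>spower\<close> this is the power with exponent
    \<open>fact (card T)\<close>, a multiple of every \<open>Suc k\<close> with
    \<open>k < card T\<close>.\<close>
  have "spower g (fact (card T) - 1) * h = h * spower g (fact (card T) - 1)" for h
  proof -
    obtain k where k: "k < card T" "spower g k * h = h * spower g k"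
      using short by blast
    then have "Suc k dvd fact (card T)"
      by (intro dvd_fact) auto
    then obtain m where m: "fact (card T) = Suc k * m" ..
    then obtain m' where "m = Suc m'"
      by (metis fact_nonzero mult_0_right not0_implies_Suc)
    with m have "fact (card T) - 1 = Suc k * m' + k"
      by (simp add: add_ac)
    then show ?thesis
      using mult[OF k(2)] by simp
  qed
  then show ?thesis
    by (auto simp: central_def)
qed

lemma central_multiple_commute:
  fixes h :: 's
  assumes "central (h * h')"
  shows "h' * h = h * h'"
proof -
  have "h * (h' * h) = h * (h * h')"
    using assms by (metis central_def mult.assoc)
  then show ?thesis by (rule left_cancel)
qed

lemma shuffles_central_multiple:
  fixes g :: 's
  assumes "shuffles E T" "g \<in> E"
  shows "\<exists>g'. central (g * g')"
proof -
  obtain n where "central (spower g n)"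
    using shuffles_central_power[OF assms] by blast
  \<comment> \<open>For \<open>n = 0\<close> the power is \<open>g\<close> alone; squaring
    guarantees a remaining cofactor \<open>g'\<close>.\<close>
  then have "central (spower g n * spower g n)"
    by (intro central_mult)
  then show ?thesis
    by (auto simp: spower_mult)
qed

text \<open>In the group of fractions, \<open>U\<close> below is \<open>w\<close> times the subgroup that stabilises all the
  translates \<open>s T\<close>.  It contains the commutators of \<open>E\<close> with the whole semigroup, so conjugation
  by \<open>g \<in> E\<close> moves \<open>u h\<close> to \<open>u' h\<close> with \<open>u' \<in> U\<close>.\<close>

lemma shuffles_stabilizer:
  fixes E T :: "'s set"
  assumes sh: "shuffles E T" and cm: "\<And>h :: 's. \<exists>h'. central (h * h')"
  obtains U w where "finite U" "w \<in> U" "central w"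
    "\<And>g u h. g \<in> E \<Longrightarrow> u \<in> U \<Longrightarrow> \<exists>u'\<in>U. g * u * h = u' * h * g"
proof -
  have T: "finite T" "T \<noteq> {}"
    and sh2: "\<And>g h s t. g \<in> E \<Longrightarrow> t \<in> T \<Longrightarrow> \<exists>t'\<in>T. g * h * s * t = h * g * s * t'"
    using sh by (auto simp: shuffles_def)
  obtain t0 where t0: "t0 \<in> T" using T by blast
  obtain t0' where cw: "central (t0 * t0')" using cm by blast
  define w where "w = t0 * t0'"
  have cw: "central w" "\<And>x. w * x = x * w" and t0': "t0' * t0 = w"
    using cw central_multiple_commute by (auto simp: w_def central_def)
  define U where "U = {u. \<forall>s. \<forall>t\<in>T. \<exists>t'\<in>T. u * s * t = w * s * t'}"
  have Ustep: "\<exists>t'\<in>T. u * s * t = w * s * t'" if "u \<in> U" "t \<in> T" for u s t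
    using that by (auto simp: U_def)
  \<comment> \<open>An element \<open>u\<close> of \<open>U\<close> is determined by the
    \<open>t\<close> in \<open>T\<close> with \<open>u * t0 = w * t\<close>.\<close>
  have "U \<subseteq> (\<lambda>t. t * t0') ` T"
  proof
    fix u assume "u \<in> U"
    then obtain t where t: "t \<in> T" "u * w * t0 = w * w * t"
      using Ustep t0 by blast
    have "w * (u * t0) = w * (w * t)"
      using t(2) cw(2) by (metis mult.assoc)
    then have "u * t0 = w * t" by (rule left_cancel)
    then have "u * w = t * t0' * w"
      using cw(2) by (metis mult.assoc w_def)
    then have "u = t * t0'" by (rule right_cancel)
    with t(1) show "u \<in> (\<lambda>t. t * t0') ` T" by blast
  qed
  then have "finite U"
    using T(1) finite_surj by blast
  moreover have "w \<in> U"
    by (auto simp: U_def)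
  moreover have "\<exists>u'\<in>U. g * u * h = u' * h * g" if g: "g \<in> E" and u: "u \<in> U" for g u h
  proof -
    \<comment> \<open>Multiplication by \<open>k\<close> replaces division by \<open>h * g\<close>,
      up to the central factor \<open>\<kappa>\<close>.\<close>
    obtain k where ck: "central (h * g * k)" using cm by blast
    define \<kappa> where "\<kappa> = h * g * k"
    have \<kappa>: "\<And>x. \<kappa> * x = x * \<kappa>" and k: "k * (h * g) = \<kappa>"
      using ck central_multiple_commute[OF ck] by (auto simp: \<kappa>_def central_def)
    \<comment> \<open>First \<open>u\<close> stabilises the translate by \<open>h * k * s\<close>,
      then the commutator of \<open>g\<close> and \<open>h\<close> stabilises the one by
      \<open>k * s\<close>.\<close>
    have move: "\<exists>t'\<in>T. g * u * h * k * s * t = w * \<kappa> * s * t'" if t: "t \<in> T" for s t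
    proof -
      obtain t1 where t1: "t1 \<in> T" "u * (h * k * s) * t = w * (h * k * s) * t1"
        using Ustep[OF u t, of "h * k * s"] by blast
      obtain t2 where t2: "t2 \<in> T" "g * h * (k * s) * t1 = h * g * (k * s) * t2"
        using sh2[OF g t1(1), of h "k * s"] by blast
      have "g * u * h * k * s * t = g * (w * (h * k * s) * t1)"
        using t1(2) by (simp add: mult.assoc)
      also have "\<dots> = w * (g * h * (k * s) * t1)"
        by (metis cw(2) mult.assoc)
      also have "\<dots> = w * \<kappa> * s * t2"
        using t2(2) by (simp add: \<kappa>_def mult.assoc)
      finally show ?thesis using t2(1) by blast
    qed
    have move1: "\<exists>t'\<in>T. g * u * h * k * t = w * \<kappa> * t'" if t: "t \<in> T" for t
    proof -
      obtain t' where t': "t' \<in> T" "g * u * h * k * w * t = w * \<kappa> * w * t'"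
        using move[OF t] by blast
      have "w * (g * u * h * k * t) = w * (w * \<kappa> * t')"
        using t'(2) by (metis cw(2) mult.assoc)
      then have "g * u * h * k * t = w * \<kappa> * t'" by (rule left_cancel)
      with t'(1) show ?thesis by blast
    qed
    then obtain t2 where t2: "t2 \<in> T" "g * u * h * k * t0 = w * \<kappa> * t2"
      using t0 by blast
    \<comment> \<open>Since \<open>t0' * t0\<close> is the central \<open>w\<close>, this solves
      \<open>g * u * h * k = \<kappa> * u'\<close> after \<open>t0\<close> is cancelled.\<close>
    define u' where "u' = t2 * t0'"
    have "g * u * h * k * t0 = \<kappa> * u' * t0"
      using t2(2) cw(2) t0' by (metis u'_def mult.assoc \<kappa>)
    then have gu: "g * u * h * k = \<kappa> * u'" by (rule right_cancel)
    have "(g * u * h) * k * (h * g) = (u' * h * g) * k * (h * g)"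
      using gu \<kappa> by (simp add: \<kappa>_def mult.assoc)
    then have eq: "g * u * h = u' * h * g"
      by (metis right_cancel)
    have "\<exists>t'\<in>T. u' * s * t = w * s * t'" if t: "t \<in> T" for s t
    proof -
      obtain t' where t': "t' \<in> T" "g * u * h * k * s * t = w * \<kappa> * s * t'"
        using move[OF t] by blast
      have "\<kappa> * (u' * s * t) = \<kappa> * (w * s * t')"
        using t'(2) gu \<kappa> by (metis mult.assoc)
      then have "u' * s * t = w * s * t'" by (rule left_cancel)
      with t'(1) show ?thesis by blast
    qed
    then have "u' \<in> U" by (auto simp: U_def)
    with eq show ?thesis by blast
  qed
  ultimately show thesis using that cw(1) by blast
qed

text \<open>With the central \<open>w = t0 * t0'\<close>, conjugation by \<open>h\<close> takes
  \<open>g * w\<close> to \<open>g * t * t0'\<close> for some \<open>t\<close> in \<open>T\<close>.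
  The finite set of such values does not depend on \<open>h\<close>.\<close>

lemma shuffles_conjugates:
  fixes E T :: "'s set"
  assumes sh: "shuffles E T" and cm: "\<And>h :: 's. \<exists>h'. central (h * h')" and "finite E"
  obtains P w where "finite P" "central w"
    "\<And>g h. g \<in> E \<Longrightarrow> \<exists>u\<in>P. g * w * h = h * u"
proof -
  have T: "finite T" "T \<noteq> {}"
    and sh1: "\<And>g h t. g \<in> E \<Longrightarrow> t \<in> T \<Longrightarrow> \<exists>t'\<in>T. g * h * t = h * g * t'"
    using sh by (auto simp: shuffles_def)
  obtain t0 where t0: "t0 \<in> T" using T by blast
  obtain t0' where cw: "central (t0 * t0')" using cm by blast
  define P where "P = (\<lambda>(g, t). g * t * t0') ` (E \<times> T)"
  show thesis
  proof
    show "finite P" using assms(3) T(1) by (simp add: P_def)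
    show "central (t0 * t0')" by fact
    fix g h assume g: "g \<in> E"
    obtain t where t: "t \<in> T" "g * h * t0 = h * g * t"
      using sh1[OF g t0] by blast
    have "g * (t0 * t0') * h = g * h * t0 * t0'"
      using cw by (metis central_def mult.assoc)
    also have "\<dots> = h * (g * t * t0')"
      using t(2) by (simp add: mult.assoc)
    finally show "\<exists>u\<in>P. g * (t0 * t0') * h = h * u"
      using g t(1) by (auto simp: P_def)
  qed
qed

text \<open>The elements \<open>gen (g * h)\<close> and \<open>gen (h * g)\<close> have the same
  product with \<open>c\<close>, so the corresponding translates of its support coincide.\<close>

lemma annihilates_commutators_shuffles:
  fixes c :: "('s, 'f::field) unital_algebra"
  assumes "annihilates_commutators (gen ` E) c" "c \<in> augmentation" "c \<noteq> 0"
  shows "shuffles E (supp c)"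
proof -
  have "\<exists>t'\<in>supp c. g * h * t = h * g * t'" if "g \<in> E" "t \<in> supp c" for g h t
  proof -
    have "gen (g * h) * c = gen (h * g) * c"
      using annihilates_commutatorsD[OF assms(1), of "gen g" "gen h" 1] that(1)
      by (simp add: gen_mult)
    then have "(*) (g * h) ` supp c = (*) (h * g) ` supp c"
      using supp_gen_mult[OF assms(2)] by metis
    then show ?thesis using that(2) by blast
  qed
  moreover have "\<exists>t'\<in>supp c. g * h * s * t = h * g * s * t'" if "g \<in> E" "t \<in> supp c" for g h s t
  proof -
    have "gen (g * h * s) * c = gen (h * g * s) * c"
      using annihilates_commutatorsD[OF assms(1), of "gen g" "gen h" "gen s"] that(1)
      by (simp add: gen_mult)
    then have "(*) (g * h * s) ` supp c = (*) (h * g * s) ` supp c"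
      using supp_gen_mult[OF assms(2)] by metis
    then show ?thesis using that(2) by blast
  qed
  ultimately show ?thesis
    using assms(2,3) by (auto simp: shuffles_def supp_empty_iff)
qed

end

section \<open>Local nilpotency of commutators\<close>

text \<open>Where the dimension is minimal, a basis of \<open>V (Suc n)\<close> extended to one of
  \<open>V n\<close> gains nothing. The span appears because the sets \<open>V n\<close> are not
  assumed to be subspaces.\<close>

lemma (in vector_space) descending_subspaces_stabilize:
  assumes "finite B" and V: "\<And>n. V n \<subseteq> span B" "\<And>n. V (Suc n) \<subseteq> V n"
  shows "\<exists>n. V n \<subseteq> span (V (Suc n))"
proof -
  obtain n where n: "\<And>m. dim (V n) \<le> dim (V m)"
    using ex_has_least_nat[of "\<lambda>_. True" 0 "\<lambda>n. dim (V n)"] by blast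
  obtain A where A: "A \<subseteq> V (Suc n)" "independent A" "V (Suc n) \<subseteq> span A" "card A = dim (V (Suc n))"
    by (rule basis_exists)
  obtain C where C: "A \<subseteq> C" "C \<subseteq> V n" "independent C" "V n \<subseteq> span C"
    using maximal_independent_subset_extend[of A "V n"] A V(2)[of n] by blast
  have "finite C"
    using independent_span_bound[of B C] assms(1) C V(1) by blast
  moreover have "card C = dim (V n)"
    using C by (simp add: basis_card_eq_dim)
  ultimately have "A = C"
    using A C(1) n[of "Suc n"] by (intro card_seteq) auto
  then show ?thesis
    using C(4) A(1) span_mono by blast
qed

lemma annihilates_commutators_span:
  fixes A :: "('s::semigroup_mult, 'f::field) unital_algebra set"
  assumes "annihilates_commutators A c"
  shows "annihilates_commutators (unital_algebra.span A) c"
  unfolding annihilates_commutators_def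
proof (intro ballI allI)
  fix a r r' :: "('s, 'f) unital_algebra"
  assume "a \<in> unital_algebra.span A" and r: "r \<in> augmentation"
  then show "(a * r - r * a) * r' * c = 0"
  proof (induction a rule: unital_algebra.span_induct_alt)
    case (step k x y)
    have "(scale k x + y) * r - r * (scale k x + y) = scale k (x * r - r * x) + (y * r - r * y)"
      by (simp add: algebra_simps unital_algebra.scale_right_diff_distrib)
    moreover have "(x * r - r * x) * r' * c = 0"
      using assms step(1) r by (simp add: annihilates_commutators_def)
    ultimately show ?case
      using step(2) r by (simp only: distrib_right mult_scale_left) simp
  qed simp
qed

text \<open>The assumption is verified through \<open>cancellative_semigroup_algebraI\<close>, once
  for a centrally essential algebra and once for a centrally essential ring of fractions.\<close>

locale cancellative_semigroup_algebra = cancellative_semigroup S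
  for S :: "'s::semigroup_mult itself" +
  fixes F :: "'f::field itself"
  assumes ex_annihilates_commutators: "\<And>A :: ('s, 'f) unital_algebra set.
    finite A \<Longrightarrow> A \<subseteq> augmentation \<Longrightarrow> \<not> A \<subseteq> {0} \<Longrightarrow>
      \<exists>c\<in>augmentation. annihilates_commutators A c \<and> (\<exists>a\<in>A. a * c \<noteq> 0)"
begin

lemma ex_shuffles:
  fixes E :: "'s set"
  assumes "finite E"
  shows "\<exists>T. shuffles E T"
proof -
  \<comment> \<open>The arbitrary element \<open>undefined\<close> makes \<open>A\<close> contain
    something nonzero even for empty \<open>E\<close>.\<close>
  define A :: "('s, 'f) unital_algebra set" where "A = gen ` (insert undefined E)"
  have "gen undefined \<noteq> (0 :: ('s, 'f) unital_algebra)"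
    by (metis coeff_gen lookup_zero zero_neq_one)
  then have "finite A" "A \<subseteq> augmentation" "\<not> A \<subseteq> {0}"
    using assms by (auto simp: A_def)
  then obtain c where c: "c \<in> augmentation" "annihilates_commutators A c" "\<exists>a\<in>A. a * c \<noteq> 0"
    using ex_annihilates_commutators by meson
  then have "c \<noteq> 0" "annihilates_commutators (gen ` E) c"
    by (auto simp: A_def annihilates_commutators_def)
  then show ?thesis
    using annihilates_commutators_shuffles c(1) by blast
qed

lemma ex_central_multiple: "\<exists>h'. central (h * h' :: 's)"
  using ex_shuffles[of "{h}"] shuffles_central_multiple[of "{h}" _ h] by auto

text \<open>Nakayama's lemma for the operators \<open>v \<mapsto> v' - v\<close>, where \<open>v'\<close> arises from \<open>v\<close> by moving it
  past a group commutator: some \<open>c\<close> is annihilated by all their values without being annihilated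
  by all of \<open>V\<close>, so \<open>V\<close> cannot consist of such values.\<close>

lemma twisted_differences_nakayama:
  fixes V W :: "('s, 'f) unital_algebra set"
  assumes B: "finite B" "V \<subseteq> unital_algebra.span B" "B \<subseteq> V"
    and "V \<subseteq> augmentation" "W \<subseteq> augmentation" and "finite E"
    and V: "V \<subseteq> unital_algebra.span {v' - v | v v' g h.
      v \<in> V \<and> v' \<in> W \<and> g \<in> E \<and> gen g * v * gen h = v' * gen h * gen g}"
  shows "V \<subseteq> {0}"
proof (rule ccontr)
  assume "\<not> V \<subseteq> {0}"
  then have "\<not> B \<subseteq> {0}"
    using B(2) unital_algebra.span_mono[of B "{0}"] by (auto simp: unital_algebra.span_insert_0)
  \<comment> \<open>The products \<open>gen g * w\<close> are included so that \<open>c\<close>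
    annihilates their commutators too.\<close>
  define A where "A = B \<union> (\<lambda>(g, w). gen g * w) ` (E \<times> B)"
  have "finite A" "A \<subseteq> augmentation" "\<not> A \<subseteq> {0}"
    using B assms(4,6) \<open>\<not> B \<subseteq> {0}\<close> by (auto simp: A_def intro!: augmentation_mult)
  then obtain c where c: "c \<in> augmentation" "annihilates_commutators A c" "\<exists>a\<in>A. a * c \<noteq> 0"
    using ex_annihilates_commutators by meson
  have annih: "annihilates_commutators (unital_algebra.span A) c"
    using c(2) by (rule annihilates_commutators_span)
  have spanA: "v \<in> unital_algebra.span A" "g \<in> E \<Longrightarrow> gen g * v \<in> unital_algebra.span A"
    if "v \<in> V" for v g
  proof -
    have "v \<in> unital_algebra.span B" using that B(2) by blast
    then show "v \<in> unital_algebra.span A"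
      using unital_algebra.span_mono[of B A] by (auto simp: A_def)
    assume g: "g \<in> E"
    show "gen g * v \<in> unital_algebra.span A"
      using \<open>v \<in> unital_algebra.span B\<close>
    proof (induction v rule: unital_algebra.span_induct_alt)
      case (step k x y)
      have "gen g * x \<in> A" using g step(1) by (auto simp: A_def)
      then show ?case
        using step(2) by (simp add: distrib_left unital_algebra.span_add unital_algebra.span_scale
            unital_algebra.span_base)
    qed (simp add: unital_algebra.span_zero)
  qed
  have zero: "(v' - v) * c = 0"
    if "v \<in> V" "v' \<in> W" "g \<in> E" and eq: "gen g * v * gen h = v' * gen h * gen g" for v v' g h
  proof -
    obtain k where k: "central (h * g * k)" using ex_central_multiple by blast
    \<comment> \<open>Two commutators vanish in front of \<open>c\<close>: that of
      \<open>gen g * v\<close> with \<open>gen h\<close>, and that of \<open>v\<close> with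
      \<open>gen (h * g)\<close>. The central \<open>h * g * k\<close> is then cancelled.\<close>
    have "v' * gen (h * g) * gen k * c = gen g * v * gen h * gen k * c"
      using eq by (simp add: gen_mult mult.assoc)
    also have "\<dots> = gen (h * g) * v * gen k * c"
      using annihilates_commutatorsD[OF annih spanA(2)[OF that(1,3)], of "gen h" "gen k"]
      by (simp add: gen_mult mult.assoc)
    also have "\<dots> = v * gen (h * g) * gen k * c"
      using annihilates_commutatorsD[OF annih spanA(1)[OF that(1)], of "gen (h * g)" "gen k"]
      by simp
    finally have "(v' - v) * gen (h * g * k) * c = 0"
      by (simp add: gen_mult left_diff_distrib mult.assoc)
    moreover have v: "v' - v \<in> augmentation"
      using that(1,2) assms(4,5) subspace_augmentation by (auto intro: unital_algebra.subspace_diff)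
    ultimately have "gen (h * g * k) * ((v' - v) * c) = 0"
      using gen_central[OF k v] by (simp flip: mult.assoc)
    then show ?thesis
      using gen_mult_eq_0(1)[OF augmentation_mult(1)[OF v]] by blast
  qed
  have "v * c = 0" if "v \<in> V" for v
  proof -
    have "v \<in> unital_algebra.span {v' - v | v v' g h.
        v \<in> V \<and> v' \<in> W \<and> g \<in> E \<and> gen g * v * gen h = v' * gen h * gen g}"
      using that V by blast
    then show ?thesis
    proof (induction v rule: unital_algebra.span_induct_alt)
      case (step k x y)
      then show ?case using zero by (auto simp: distrib_right)
    qed simp
  qed
  then have "a * c = 0" if "a \<in> A" for a
    using that B(3) by (auto simp: A_def mult.assoc)
  with c(3) show False by blast
qed

text \<open>Twisted differences filter the finite-dimensional span \<open>W\<close> of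
  \<open>U\<close>. The filtration stabilises, and Nakayama's argument makes its stable term zero.
  Each commutator with \<open>b\<close> descends one layer, so an iterate kills
  \<open>gen w * x\<close>, and the central \<open>gen w\<close> cancels.\<close>

lemma commutator_nilpotent:
  fixes b x :: "('s, 'f) unital_algebra"
  assumes b: "b \<in> augmentation" and x: "x \<in> augmentation"
  shows "\<exists>n. ((\<lambda>x. b * x - x * b) ^^ n) x = 0"
proof -
  define E where "E = supp b"
  obtain T where "shuffles E T"
    using ex_shuffles[of E] by (auto simp: E_def)
  then obtain U w where U: "finite U" "w \<in> U" "central w"
      "\<And>g u h. g \<in> E \<Longrightarrow> u \<in> U \<Longrightarrow> \<exists>u'\<in>U. g * u * h = u' * h * g"
    by (rule shuffles_stabilizer[OF _ ex_central_multiple]) blast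
  define W :: "('s, 'f) unital_algebra set" where "W = unital_algebra.span (gen ` U)"
  define \<Phi> where "\<Phi> V = unital_algebra.span {v' - v | v v' g h.
      v \<in> V \<and> v' \<in> W \<and> g \<in> E \<and> gen g * v * gen h = v' * gen h * gen g}" for V
  define V where "V n = (\<Phi> ^^ n) W" for n
  have W_aug: "W \<subseteq> augmentation"
    unfolding W_def using subspace_augmentation by (intro unital_algebra.span_minimal) auto
  have twist: "\<exists>v'\<in>W. gen g * v * gen h = v' * gen h * gen g" if "v \<in> W" and g: "g \<in> E" for v g h
    using that(1) unfolding W_def
  proof (induction v rule: unital_algebra.span_induct_alt)
    case base
    then show ?case by (intro bexI[of _ 0]) (simp_all add: unital_algebra.span_zero)
  next
    case (step k x y)
    then obtain u where u: "u \<in> U" "x = gen u" by blast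
    obtain u' where u': "u' \<in> U" "g * u * h = u' * h * g"
      using U(4) g u(1) by blast
    obtain y' where y': "y' \<in> unital_algebra.span (gen ` U)" "gen g * y * gen h = y' * gen h * gen g"
      using step(2) by blast
    have "gen g * x * gen h = gen u' * gen h * gen g"
      using u'(2) u(2) by (metis gen_mult)
    then have "gen g * (scale k x + y) * gen h = (scale k (gen u') + y') * gen h * gen g"
      using y'(2) by (simp add: distrib_left distrib_right)
    then show ?case
      using u'(1) y'(1)
      by (intro bexI[of _ "scale k (gen u') + y'"])
        (auto intro: unital_algebra.span_add unital_algebra.span_scale unital_algebra.span_base)
  qed
  have mono: "\<Phi> V \<subseteq> \<Phi> V'" if "V \<subseteq> V'" for V V'
    unfolding \<Phi>_def using that by (intro unital_algebra.span_mono) blast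
  have "\<Phi> W \<subseteq> W"
    unfolding \<Phi>_def
    by (rule unital_algebra.span_minimal) (auto simp: W_def intro: unital_algebra.span_diff)
  then have dec: "V (Suc n) \<subseteq> V n" for n
    by (induction n) (auto simp: V_def intro!: mono)
  have V_W: "V n \<subseteq> W" for n
    using dec by (induction n) (auto simp: V_def)
  have "\<exists>n. V n \<subseteq> unital_algebra.span (V (Suc n))"
  proof (rule unital_algebra.descending_subspaces_stabilize)
    show "finite (gen ` U)" using U(1) by simp
    show "V n \<subseteq> unital_algebra.span (gen ` U)" for n using V_W[of n] unfolding W_def .
  qed (rule dec)
  then obtain n where "V n \<subseteq> unital_algebra.span (V (Suc n))" ..
  also have "\<dots> = \<Phi> (V n)"
    by (simp add: V_def \<Phi>_def unital_algebra.span_span)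
  finally have stable: "V n \<subseteq> \<Phi> (V n)" .
  obtain B where B: "B \<subseteq> V n" "unital_algebra.independent B" "V n \<subseteq> unital_algebra.span B"
    "card B = unital_algebra.dim (V n)"
    by (rule unital_algebra.basis_exists)
  have "B \<subseteq> unital_algebra.span (gen ` U)"
    using B(1) V_W[of n] unfolding W_def by (rule subset_trans)
  then have "finite B"
    using unital_algebra.independent_span_bound[of "gen ` U" B] U(1) B(2) by simp
  have Vn: "V n \<subseteq> {0}"
  proof (rule twisted_differences_nakayama[OF \<open>finite B\<close> B(3) B(1) _ W_aug])
    show "V n \<subseteq> augmentation" using V_W W_aug by (rule subset_trans)
    show "finite E" by (simp add: E_def)
  qed (rule stable[unfolded \<Phi>_def])
  \<comment> \<open>The filtration is carried from \<open>W\<close> to the products of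
    \<open>W\<close> with the semigroup algebra.\<close>
  define X where "X V = unital_algebra.span {v * gen h | v h. v \<in> V}"
    for V :: "('s, 'f) unital_algebra set"
  \<comment> \<open>For \<open>y = v * gen h\<close> the commutator with \<open>gen g\<close> is
    \<open>(v' - v) * gen (h * g)\<close>, where \<open>v' - v\<close> lies in
    \<open>\<Phi> V\<close>.\<close>
  have ad_X: "b * y - y * b \<in> X (\<Phi> V)" if "y \<in> X V" "V \<subseteq> W" for y V
    using that(1) unfolding X_def[of V]
  proof (induction y rule: unital_algebra.span_induct_alt)
    case base
    then show ?case by (simp add: X_def unital_algebra.span_zero)
  next
    case (step k y z)
    then obtain v h where v: "v \<in> V" "y = v * gen h" by blast
    have "gen g * y - y * gen g \<in> X (\<Phi> V)" if gE: "g \<in> E" for g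
    proof -
      obtain v' where v': "v' \<in> W" "gen g * v * gen h = v' * gen h * gen g"
        using twist[OF _ gE] v(1) \<open>V \<subseteq> W\<close> by blast
      then have "v' - v \<in> \<Phi> V"
        unfolding \<Phi>_def using v(1) gE by (intro unital_algebra.span_base) blast
      moreover have "gen g * y - y * gen g = (v' - v) * gen (h * g)"
        using v'(2) v(2) by (simp add: gen_mult left_diff_distrib mult.assoc)
      ultimately show ?thesis
        unfolding X_def by (intro unital_algebra.span_base) blast
    qed
    then have "(\<Sum>g\<in>E. scale (coeff b g) (gen g * y - y * gen g)) \<in> X (\<Phi> V)"
      unfolding X_def by (intro unital_algebra.span_sum unital_algebra.span_scale)
    also have "(\<Sum>g\<in>E. scale (coeff b g) (gen g * y - y * gen g)) = b * y - y * b"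
      by (subst (2 3) augmentation_expand[OF b])
        (simp add: E_def sum_distrib_left sum_distrib_right sum_subtractf
          unital_algebra.scale_right_diff_distrib)
    finally have "b * y - y * b \<in> X (\<Phi> V)" .
    moreover have "b * (scale k y + z) - (scale k y + z) * b =
        scale k (b * y - y * b) + (b * z - z * b)"
      by (simp add: algebra_simps unital_algebra.scale_right_diff_distrib)
    ultimately show ?case
      using step(2) unfolding X_def
      by (auto intro: unital_algebra.span_add unital_algebra.span_scale)
  qed
  let ?ad = "\<lambda>x. b * x - x * b"
  \<comment> \<open>The factor \<open>gen w\<close> brings \<open>x\<close> into \<open>X W\<close>,
    since \<open>w\<close> is in \<open>U\<close>.\<close>
  have "(?ad ^^ m) (gen w * x) \<in> X (V m)" for m
  proof (induction m)
    case 0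
    have "gen w * x = (\<Sum>h\<in>supp x. scale (coeff x h) (gen w * gen h))"
      by (subst augmentation_expand[OF x]) (simp add: sum_distrib_left)
    moreover have "gen w * gen h \<in> X W" for h
      using U(2) unfolding X_def W_def by (intro unital_algebra.span_base) (blast intro: unital_algebra.span_base)
    ultimately show ?case
      unfolding V_def X_def by (auto intro: unital_algebra.span_sum unital_algebra.span_scale)
  next
    case (Suc m)
    then show ?case
      using ad_X[OF Suc V_W] by (simp add: V_def)
  qed
  moreover have "X (V n) \<subseteq> {0}"
    unfolding X_def using Vn
    by (intro unital_algebra.span_minimal) (auto simp: unital_algebra.subspace_0 unital_algebra.subspace_def)
  ultimately have zero: "(?ad ^^ n) (gen w * x) = 0"
    by blast
  have aug: "(?ad ^^ m) x \<in> augmentation" for m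
    using x b subspace_augmentation
    by (induction m) (auto intro: unital_algebra.subspace_diff augmentation_mult)
  have "(?ad ^^ m) (gen w * x) = gen w * (?ad ^^ m) x" for m
  proof (induction m)
    case (Suc m)
    then show ?case
      using gen_central[OF U(3) b] by (simp add: right_diff_distrib flip: mult.assoc)
  qed simp
  then have "gen w * (?ad ^^ n) x = 0"
    using zero by metis
  then show ?thesis
    using gen_mult_eq_0(1)[OF aug] by blast
qed

text \<open>Conjugation by \<open>g\<close> acts cyclically on \<open>v 0\<close>, ...,
  \<open>v (K - 1)\<close> because a power of \<open>g\<close> is central. The deviations
  \<open>a j\<close> from the average have sum zero, but would all agree on a suitable
  \<open>c\<close>; hence they vanish, the \<open>v j\<close> coincide, and \<open>g\<close>
  commutes with \<open>u\<close>.\<close>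

lemma commutative_of_char_0:
  assumes "CHAR('f) = 0"
  shows "(g::'s) * u = u * g"
proof -
  obtain T where "shuffles {g} T"
    using ex_shuffles[of "{g}"] by auto
  then obtain n where n: "central (spower g n)"
    using shuffles_central_power by blast
  have of_nat_eq: "i = j" if "(of_nat i :: 'f) = of_nat j" for i j
    using that
  proof (induction i j rule: linorder_wlog)
    case (le i j)
    then have "of_nat (j - i) = (0 :: 'f)" by (simp add: of_nat_diff)
    then have "CHAR('f) dvd j - i" by (simp only: of_nat_eq_0_iff_char_dvd)
    then show ?case using assms le(1) by simp
  qed simp
  define G where "G = (gen g :: ('s, 'f) unital_algebra)"
  \<comment> \<open>This is the true exponent of \<open>spower g n\<close>.\<close>
  define K where "K = Suc n"
  have G_pow: "G ^ K = gen (spower g n)"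
    unfolding K_def by (induction n) (simp_all add: G_def gen_mult)
  have "K > 0" by (simp add: K_def)
  have "\<exists>h. G ^ i * gen u = gen h" for i
  proof (induction i)
    case (Suc i)
    then obtain h where "G ^ i * gen u = gen h" ..
    then have "G ^ Suc i * gen u = gen (g * h)"
      by (simp add: mult.assoc) (simp add: G_def gen_mult)
    then show ?case by blast
  qed auto
  moreover have "\<exists>h'. gen h * G ^ j = gen h'" for h j
  proof (induction j)
    case (Suc j)
    then obtain h' where "gen h * G ^ j = gen h'" ..
    then have "gen h * G ^ Suc j = gen (h' * g)"
      by (simp add: power_Suc2 del: power_Suc flip: mult.assoc) (simp add: G_def gen_mult)
    then show ?case by blast
  qed auto
  ultimately have "\<forall>i. \<exists>h. gen h = G ^ i * gen u * G ^ (K - i)"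
    by metis
  \<comment> \<open>Up to the central factor \<open>G ^ K\<close>, these are the conjugates of
    \<open>u\<close> by powers of \<open>g\<close>; the factor keeps them inside the
    semigroup.\<close>
  then obtain v where v: "\<And>i. gen (v i) = G ^ i * gen u * G ^ (K - i)"
    by metis
  have G_aug: "G ^ j \<in> augmentation" if "j > 0" for j
    using that augmentation_mult(1)[of G] by (cases j) (simp_all add: G_def)
  have GK: "G ^ K * y = y * G ^ K" if "y \<in> augmentation" for y
    unfolding G_pow using gen_central[OF n that] .
  have "gen (v K) = (gen (v 0) :: ('s, 'f) unital_algebra)"
    by (simp add: v GK)
  then have vK: "v K = v 0" by simp
  have step: "G * gen (v i) = gen (v (Suc i)) * G" if "i < K" for i
  proof -
    have "G ^ (K - i) = G ^ (K - Suc i) * G"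
      using that by (metis Suc_diff_Suc power_Suc2)
    then show ?thesis by (simp add: v mult.assoc)
  qed
  define \<Sigma> where "\<Sigma> = (\<Sum>i<K. gen (v i) :: ('s, 'f) unital_algebra)"
  define a where "a j = scale (of_nat K) (gen (v j)) - \<Sigma>" for j
  have "\<Sigma> = (\<Sum>i<K. gen (v (Suc i)))"
    using sum.lessThan_Suc_shift[of "\<lambda>i. gen (v i) :: ('s, 'f) unital_algebra" K] vK
    by (simp add: \<Sigma>_def add.commute)
  then have "\<Sigma> * G = (\<Sum>i<K. G * gen (v i))"
    using step by (simp add: sum_distrib_right)
  then have "G * \<Sigma> = \<Sigma> * G"
    by (simp add: \<Sigma>_def sum_distrib_left)
  then have a_step: "G * a i = a (Suc i) * G" if "i < K" for i
    using step[OF that] by (simp add: a_def algebra_simps)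
  have a_pow: "G ^ j * a 0 = a j * G ^ j" if "j \<le> K" for j
    using that
  proof (induction j)
    case (Suc j)
    then have "G ^ Suc j * a 0 = G * a j * G ^ j" by (simp add: mult.assoc)
    then show ?case using a_step[of j] Suc.prems by (simp add: mult.assoc)
  qed simp
  have aug: "a j \<in> augmentation" for j
    unfolding a_def \<Sigma>_def using subspace_augmentation
    by (intro unital_algebra.subspace_diff unital_algebra.subspace_scale unital_algebra.subspace_sum) auto
  have "a 0 = 0"
  proof (rule ccontr)
    assume "a 0 \<noteq> 0"
    then have "finite {a 0}" "{a 0} \<subseteq> augmentation" "\<not> {a 0} \<subseteq> {0}"
      using aug by auto
    from ex_annihilates_commutators[OF this] obtain c
      where c: "c \<in> augmentation" "annihilates_commutators {a 0} c" "a 0 * c \<noteq> 0"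
      by auto
    \<comment> \<open>\<open>G ^ j\<close> carries \<open>a 0\<close> to \<open>a j\<close>, while
      the commutator of \<open>a 0\<close> with \<open>G ^ j\<close> vanishes in front of
      \<open>c\<close>. The case \<open>j = 0\<close> is separate because \<open>1\<close> is
      outside \<open>augmentation\<close>.\<close>
    have "a j * c = a 0 * c" if "j < K" for j
    proof -
      have "a j * G ^ K * c = a j * G ^ j * G ^ (K - j) * c"
        using that by (simp add: mult.assoc flip: power_add)
      also have "\<dots> = G ^ j * a 0 * G ^ (K - j) * c"
        using a_pow[of j] that by simp
      also have "\<dots> = a 0 * G ^ j * G ^ (K - j) * c"
        using annihilates_commutatorsD[OF c(2), of "a 0" "G ^ j" "G ^ (K - j)"] G_aug[of j]
        by (cases "j = 0") auto
      also have "\<dots> = a 0 * G ^ K * c"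
        using that by (simp add: mult.assoc flip: power_add)
      finally have "G ^ K * (a j * c) = G ^ K * (a 0 * c)"
        using GK[OF aug[of j]] GK[OF aug[of 0]] by (simp flip: mult.assoc)
      then show ?thesis
        unfolding G_pow by (simp add: gen_cancel augmentation_mult aug)
    qed
    then have "(\<Sum>j<K. a j) * c = (\<Sum>j<K. a 0 * c)"
      unfolding sum_distrib_right by (intro sum.cong refl) (metis lessThan_iff)
    also have "\<dots> = scale (of_nat K) (a 0 * c)"
      by (simp only: unital_algebra.sum_constant_scale card_lessThan)
    finally have "(\<Sum>j<K. a j) * c = scale (of_nat K) (a 0 * c)" .
    moreover have "(\<Sum>j<K. a j) = scale (of_nat K) \<Sigma> - (\<Sum>j<K. \<Sigma>)"
      unfolding a_def sum_subtractf by (simp only: \<Sigma>_def unital_algebra.scale_sum_right)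
    then have "(\<Sum>j<K. a j) = 0"
      by (simp only: unital_algebra.sum_constant_scale card_lessThan diff_self)
    ultimately have "of_nat K = (0::'f)"
      using c(3) by simp
    then show False
      using \<open>K > 0\<close> of_nat_eq[of K 0] by simp
  qed
  \<comment> \<open>This coefficient is \<open>K\<close> minus the number of indices with
    \<open>v i = v 0\<close>. In characteristic zero its vanishing forces all the \<open>v i\<close>
    to be equal.\<close>
  then have "coeff (a 0) (v 0) = 0" by simp
  then have "of_nat K = (\<Sum>i<K. if v i = v 0 then 1 else 0 :: 'f)"
    by (simp add: a_def \<Sigma>_def lookup_minus lookup_sum)
  also have "\<dots> = of_nat (card {i \<in> {..<K}. v i = v 0})"
    by (simp flip: sum.inter_filter)
  finally have "of_nat K = (of_nat (card {i \<in> {..<K}. v i = v 0}) :: 'f)" .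
  from of_nat_eq[OF this[symmetric]] have "card {i \<in> {..<K}. v i = v 0} = card {..<K}"
    by simp
  then have all: "{i \<in> {..<K}. v i = v 0} = {..<K}"
    by (rule card_subset_eq[rotated 2]) auto
  have "v 1 = v 0"
  proof (cases "K = 1")
    case False
    then have "1 \<in> {..<K}" using \<open>K > 0\<close> by simp
    then have "1 \<in> {i \<in> {..<K}. v i = v 0}" by (simp only: all)
    then show ?thesis by blast
  qed (use vK in simp)
  then have "G * gen (v 0) = gen (v 0) * G"
    using step[OF \<open>K > 0\<close>] by (simp only: One_nat_def)
  then have "g * v 0 = v 0 * g"
    by (simp add: G_def flip: gen_mult)
  moreover have "v 0 = u * spower g n"
    using v[of 0] by (simp add: G_pow flip: gen_mult)
  moreover have "spower g n * g = g * spower g n"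
    using n by (simp add: central_def)
  ultimately have "(g * u) * spower g n = (u * g) * spower g n"
    by (simp add: mult.assoc)
  then show ?thesis by (rule right_cancel)
qed

text \<open>In characteristic zero the algebra is commutative. In characteristic \<open>p\<close>
  the exponent \<open>p ^ n\<close> is at least the nilpotency index \<open>n\<close>, and at that
  exponent the iterated commutator is a single commutator.\<close>

lemma power_commute:
  fixes x y :: "('s, 'f) unital_algebra"
  assumes x: "x \<in> augmentation" and y: "y \<in> augmentation"
  shows "\<exists>q>0. x ^ q * y = y * x ^ q"
proof (cases "CHAR('f) = 0")
  case True
  have "central s" for s :: 's
    unfolding central_def using commutative_of_char_0[OF True] by blast
  then have "gen s * y = y * gen s" for s
    using gen_central y by blast
  then have "x * y = y * x"
    by (rule augmentation_commute[OF x])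
  then show ?thesis by (intro exI[of _ 1]) simp
next
  case False
  define p where "p = CHAR('f)"
  have "prime p"
    using False prime_CHAR_semidom unfolding p_def by blast
  have p0: "of_nat p = (0 :: ('s, 'f) unital_algebra)"
    unfolding p_def using of_nat_CHAR[where ?'a = 'f]
    by (intro poly_mapping_eqI) (simp add: lookup_of_nat)
  let ?ad = "\<lambda>y. x * y - y * x"
  obtain n where n: "(?ad ^^ n) y = 0"
    using commutator_nilpotent[OF x y] ..
  have zero: "(?ad ^^ (m + n)) y = 0" for m
    by (induction m) (simp_all add: n)
  have "n \<le> p ^ n"
    using power_gt_expt[of p n] prime_gt_1_nat[OF \<open>prime p\<close>] by simp
  then have "(?ad ^^ (p ^ n)) y = 0"
    using zero[of "p ^ n - n"] by simp
  then have "x ^ (p ^ n) * y = y * x ^ (p ^ n)"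
    by (simp only: funpow_commutator_prime_power[OF \<open>prime p\<close> p0] right_minus_eq)
  then show ?thesis
    using prime_gt_0_nat[OF \<open>prime p\<close>] by (intro exI[of _ "p ^ n"]) simp
qed

end

section \<open>Central multiples of regular elements\<close>

context cancellative_semigroup_algebra
begin

text \<open>The multiple \<open>b0 = b * gen w\<close> has finitely many conjugates, with commuting
  powers by \<open>power_commute\<close>. Their norm is central, and it is regular because every
  conjugate inherits left regularity from \<open>b\<close>.\<close>

lemma left_regular_divides_central:
  fixes b :: "('s, 'f) unital_algebra"
  assumes b: "b \<in> augmentation" and reg: "\<And>x. x \<in> augmentation \<Longrightarrow> b * x = 0 \<Longrightarrow> x = 0"
  shows "\<exists>c\<in>augmentation. \<forall>x\<in>augmentation.
    b * c * x = x * (b * c) \<and> (b * c * x = 0 \<longrightarrow> x = 0)"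
proof -
  define E where "E = supp b"
  have "finite E" by (simp add: E_def)
  obtain T where "shuffles E T"
    using ex_shuffles[OF \<open>finite E\<close>] ..
  then obtain P w where P: "finite P" "central w" "\<And>g h. g \<in> E \<Longrightarrow> \<exists>u\<in>P. g * w * h = h * u"
    by (rule shuffles_conjugates[OF _ ex_central_multiple \<open>finite E\<close>]) blast
  define b0 where "b0 = b * gen w"
  have b0: "b0 \<in> augmentation"
    unfolding b0_def using b by (rule augmentation_mult)
  \<comment> \<open>Each conjugate of \<open>b0\<close> has this form, with \<open>f\<close>
    choosing a conjugate of \<open>g * w\<close> for every \<open>g\<close> in the support.\<close>
  define \<phi> where "\<phi> f = (\<Sum>g\<in>E. scale (coeff b g) (gen (f g)))" for f :: "'s \<Rightarrow> 's"
  have \<phi>_aug: "\<phi> f \<in> augmentation" for f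
    unfolding \<phi>_def using subspace_augmentation
    by (intro unital_algebra.subspace_sum unital_algebra.subspace_scale) auto
  have conj: "\<exists>f\<in>E \<rightarrow>\<^sub>E P. b0 * gen h = gen h * \<phi> f" for h
  proof -
    have "\<forall>g\<in>E. \<exists>u. u \<in> P \<and> g * w * h = h * u"
      using P(3) by blast
    from bchoice[OF this] obtain f where f: "\<And>g. g \<in> E \<Longrightarrow> f g \<in> P \<and> g * w * h = h * f g"
      by blast
    have "b0 * gen h = (\<Sum>g\<in>E. scale (coeff b g) (gen (g * w * h)))"
      unfolding b0_def
      by (subst augmentation_expand[OF b]) (simp add: E_def sum_distrib_right gen_mult)
    \<comment> \<open>Restricting \<open>f\<close> to \<open>E\<close> leaves only finitely many
      possible choices.\<close>
    also have "\<dots> = gen h * \<phi> (restrict f E)"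
      using f by (simp add: \<phi>_def sum_distrib_left gen_mult)
    finally show ?thesis
      using f by (intro bexI[of _ "restrict f E"]) auto
  qed
  define B where "B = {b' \<in> augmentation. \<exists>h. b0 * gen h = gen h * b'}"
  have "B \<subseteq> \<phi> ` (E \<rightarrow>\<^sub>E P)"
  proof
    fix b' assume "b' \<in> B"
    then obtain h where b': "b' \<in> augmentation" "b0 * gen h = gen h * b'"
      by (auto simp: B_def)
    obtain f where f: "f \<in> E \<rightarrow>\<^sub>E P" "b0 * gen h = gen h * \<phi> f"
      using conj by blast
    then have "b' = \<phi> f"
      using b' gen_cancel(1)[OF b'(1) \<phi>_aug] by metis
    with f(1) show "b' \<in> \<phi> ` (E \<rightarrow>\<^sub>E P)" by blast
  qed
  then have "finite B"
    using finite_PiE[OF \<open>finite E\<close>, of "\<lambda>_. P"] P(1) finite_surj by blast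
  moreover have "b0 \<in> B"
    using b0 gen_central[OF P(2) b0, symmetric] by (auto simp: B_def)
  moreover have "\<exists>q>0. x ^ q * y = y * x ^ q" if "x \<in> B" "y \<in> B" for x y
    using that by (intro power_commute) (auto simp: B_def)
  ultimately obtain xs where xs: "xs \<noteq> []" "set xs \<subseteq> B"
    and comm: "\<forall>s. (\<forall>x\<in>B. \<exists>y\<in>B. x * s = s * y) \<and> inj_on (\<lambda>x. x * s) B \<longrightarrow>
      b0 * prod_list xs * s = s * (b0 * prod_list xs)"
    by (rule conjugation_invariant_multiple)
  define c where "c = gen w * prod_list xs"
  have c: "c \<in> augmentation"
    unfolding c_def by (intro augmentation_mult) simp
  have bc: "b * c = b0 * prod_list xs"
    by (simp add: c_def b0_def mult.assoc)
  have gen_bc: "gen s * (b * c) = (b * c) * gen s" for s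
    unfolding bc
  proof (rule comm[rule_format, symmetric], intro conjI ballI)
    fix x assume "x \<in> B"
    then obtain h where x: "x \<in> augmentation" "b0 * gen h = gen h * x"
      by (auto simp: B_def)
    obtain f where f: "b0 * gen (h * s) = gen (h * s) * \<phi> f"
      using conj by blast
    then have "gen h * (x * gen s) = gen h * (gen s * \<phi> f)"
      using x(2) by (simp add: gen_mult flip: mult.assoc)
    then have "x * gen s = gen s * \<phi> f"
      using gen_cancel(1)[OF augmentation_mult(1)[OF x(1)] augmentation_mult(2)[OF \<phi>_aug]] by blast
    moreover have "\<phi> f \<in> B"
      using f \<phi>_aug by (auto simp: B_def)
    ultimately show "\<exists>y\<in>B. x * gen s = gen s * y" by blast
  next
    show "inj_on (\<lambda>x. x * gen s) B"
      by (rule inj_onI) (auto simp: B_def gen_cancel)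
  qed
  have central: "b * c * x = x * (b * c)" if "x \<in> augmentation" for x
    by (rule augmentation_commute[OF that gen_bc, symmetric])
  \<comment> \<open>From \<open>b0 * gen h = gen h * b'\<close>, an annihilated \<open>x\<close>
    gives \<open>gen w * (gen h * x)\<close> annihilated by \<open>b\<close>.\<close>
  have B_reg: "x = 0" if "b' \<in> B" and x: "x \<in> augmentation" and "b' * x = 0" for b' x
  proof -
    obtain h where h: "b0 * gen h = gen h * b'"
      using \<open>b' \<in> B\<close> by (auto simp: B_def)
    have "b * (gen w * (gen h * x)) = gen h * (b' * x)"
      using h by (simp add: b0_def flip: mult.assoc)
    then have "gen w * (gen h * x) = 0"
      using \<open>b' * x = 0\<close> x by (rule_tac reg) (simp_all add: augmentation_mult)
    then show "x = 0"
      by (simp add: gen_mult_eq_0 x augmentation_mult)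
  qed
  have prod_reg: "x = 0" if "set ys \<subseteq> B" "x \<in> augmentation" "prod_list ys * x = 0" for x ys
    using that
  proof (induction ys)
    case (Cons y ys)
    then have "prod_list ys * x = 0"
      using B_reg[of y "prod_list ys * x"] by (simp add: mult.assoc augmentation_mult)
    then show ?case using Cons by simp
  qed simp
  have regular: "x = 0" if "x \<in> augmentation" "b * c * x = 0" for x
  proof (rule prod_reg[OF xs(2) that(1)])
    show "prod_list xs * x = 0"
      using that by (rule_tac B_reg[OF \<open>b0 \<in> B\<close>]) (simp_all add: bc mult.assoc augmentation_mult)
  qed
  show ?thesis
    using c central regular by (intro bexI[of _ c] ballI conjI impI)
qed

end

section \<open>Fractions with central denominators\<close>

text \<open>Localization at central regular elements of a ring that need not have an identity.
  Central denominators allow the usual cross multiplication of commutative algebra.\<close>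

locale central_denominators =
  fixes mul :: "'a::ab_group_add \<Rightarrow> 'a \<Rightarrow> 'a" (infixl "\<cdot>" 70) and D :: "'a set"
  assumes assoc: "x \<cdot> y \<cdot> z = x \<cdot> (y \<cdot> z)"
    and add_mul: "(x + y) \<cdot> z = x \<cdot> z + y \<cdot> z"
    and mul_add: "z \<cdot> (x + y) = z \<cdot> x + z \<cdot> y"
    and D_nonempty: "D \<noteq> {}"
    and D_mult: "d \<in> D \<Longrightarrow> e \<in> D \<Longrightarrow> d \<cdot> e \<in> D"
    and D_central: "d \<in> D \<Longrightarrow> d \<cdot> x = x \<cdot> d"
    and D_regular: "d \<in> D \<Longrightarrow> x \<cdot> d = 0 \<Longrightarrow> x = 0"
begin

lemma mul_zero [simp]: "x \<cdot> 0 = 0" "0 \<cdot> x = 0"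
  using mul_add[of x 0 0] add_mul[of 0 0 x] by simp_all

lemma mul_minus: "(- x) \<cdot> y = - (x \<cdot> y)"
  using add_mul[of "- x" x y] by (simp add: eq_neg_iff_add_eq_0)

lemma D_cancel: "d \<in> D \<Longrightarrow> x \<cdot> d = y \<cdot> d \<longleftrightarrow> x = y"
  using D_regular[of d "x - y"] add_mul[of x "- y" d] by (auto simp: mul_minus)

lemma D_right_commute: "d \<in> D \<Longrightarrow> x \<cdot> d \<cdot> y = x \<cdot> y \<cdot> d"
  by (metis assoc D_central)

definition frac :: "'a \<Rightarrow> 'a \<Rightarrow> 'a fraction" where
  "frac a d = {(b, e). e \<in> D \<and> a \<cdot> e = b \<cdot> d}"

text \<open>The content is transitivity of cross multiplication: multiply by the third denominator,
  move denominators past numerators and cancel one.\<close>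

lemma frac_eq_iff:
  assumes "d \<in> D" "e \<in> D"
  shows "frac a d = frac b e \<longleftrightarrow> a \<cdot> e = b \<cdot> d"
proof
  assume "frac a d = frac b e"
  moreover have "(b, e) \<in> frac b e" using assms(2) by (simp add: frac_def)
  ultimately have "(b, e) \<in> frac a d" by simp
  then show "a \<cdot> e = b \<cdot> d" by (simp add: frac_def)
next
  have "frac a d \<subseteq> frac b e"
    if "d \<in> D" "e \<in> D" and eq: "a \<cdot> e = b \<cdot> d" for a b d e
  proof (clarsimp simp: frac_def)
    fix c f assume "f \<in> D" "a \<cdot> f = c \<cdot> d"
    have "b \<cdot> f \<cdot> d = a \<cdot> e \<cdot> f"
      using D_right_commute[OF \<open>f \<in> D\<close>, of b d] eq by simp
    also have "\<dots> = c \<cdot> e \<cdot> d"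
      using D_right_commute[OF \<open>e \<in> D\<close>, of a f] D_right_commute[OF \<open>e \<in> D\<close>, of c d]
        \<open>a \<cdot> f = c \<cdot> d\<close> by simp
    finally show "b \<cdot> f = c \<cdot> e"
      using D_cancel[OF \<open>d \<in> D\<close>] by blast
  qed
  from this[of d e a b] this[of e d b a] assms
  show "frac a d = frac b e" if "a \<cdot> e = b \<cdot> d"
    using that by auto
qed

lemma frac_expand: "d \<in> D \<Longrightarrow> e \<in> D \<Longrightarrow> frac (a \<cdot> e) (d \<cdot> e) = frac a d"
  by (simp add: frac_eq_iff D_mult) (simp add: assoc D_central[of d])

text \<open>The fraction inside the union is the same for all representatives, so the union is that
  common value; \<open>UN_frac\<close> makes this precise.\<close>

definition frac_add :: "'a fraction \<Rightarrow> 'a fraction \<Rightarrow> 'a fraction" where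
  "frac_add X Y = (\<Union>(a, d)\<in>X. \<Union>(b, e)\<in>Y. frac (a \<cdot> e + b \<cdot> d) (d \<cdot> e))"

definition frac_mult :: "'a fraction \<Rightarrow> 'a fraction \<Rightarrow> 'a fraction" where
  "frac_mult X Y = (\<Union>(a, d)\<in>X. \<Union>(b, e)\<in>Y. frac (a \<cdot> b) (d \<cdot> e))"

lemma UN_frac:
  assumes "d \<in> D" "e \<in> D" and
    "\<And>a' d' b' e'. d' \<in> D \<Longrightarrow> e' \<in> D \<Longrightarrow> a \<cdot> d' = a' \<cdot> d \<Longrightarrow> b \<cdot> e' = b' \<cdot> e \<Longrightarrow> f a' d' b' e' = X"
  shows "(\<Union>(a', d')\<in>frac a d. \<Union>(b', e')\<in>frac b e. f a' d' b' e') = X"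
proof -
  have "(a, d) \<in> frac a d" "(b, e) \<in> frac b e"
    using assms(1,2) by (simp_all add: frac_def)
  moreover have "f a' d' b' e' = X" if "(a', d') \<in> frac a d" "(b', e') \<in> frac b e" for a' d' b' e'
    using that assms(3) by (auto simp: frac_def)
  ultimately show ?thesis by fast
qed

lemma frac_add:
  assumes "d \<in> D"
  shows "frac_add (frac a d) (frac b d) = frac (a + b) d"
  unfolding frac_add_def
proof (rule UN_frac[OF assms assms])
  fix a' d' b' e' assume D: "d' \<in> D" "e' \<in> D" and eq: "a \<cdot> d' = a' \<cdot> d" "b \<cdot> e' = b' \<cdot> d"
  have "a' \<cdot> e' \<cdot> d = a \<cdot> (d' \<cdot> e')"
    using eq(1) D_right_commute[OF assms, of a' e'] by (simp flip: assoc)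
  moreover have "b' \<cdot> d' \<cdot> d = b \<cdot> (d' \<cdot> e')"
    using eq(2) D_right_commute[OF D(1), of b' d] D_right_commute[OF D(1), of b e']
    by (simp flip: assoc)
  ultimately show "frac (a' \<cdot> e' + b' \<cdot> d') (d' \<cdot> e') = frac (a + b) d"
    using assms D by (simp add: frac_eq_iff D_mult add_mul)
qed

lemma frac_mult:
  assumes "d \<in> D" "e \<in> D"
  shows "frac_mult (frac a d) (frac b e) = frac (a \<cdot> b) (d \<cdot> e)"
  unfolding frac_mult_def
proof (rule UN_frac[OF assms])
  fix a' d' b' e' assume D: "d' \<in> D" "e' \<in> D" and eq: "a \<cdot> d' = a' \<cdot> d" "b \<cdot> e' = b' \<cdot> e"
  have "a' \<cdot> b' \<cdot> (d \<cdot> e) = a' \<cdot> d \<cdot> (b' \<cdot> e)"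
    using D_right_commute[OF assms(1), of a' b'] by (simp flip: assoc)
  also have "\<dots> = a \<cdot> b \<cdot> (d' \<cdot> e')"
    using D_right_commute[OF D(1), of a b] by (simp flip: assoc eq)
  finally show "frac (a' \<cdot> b') (d' \<cdot> e') = frac (a \<cdot> b) (d \<cdot> e)"
    using assms D by (simp add: frac_eq_iff D_mult)
qed

text \<open>An arbitrary denominator. For lack of an identity, \<open>1\<close> is represented by
  \<open>d0 / d0\<close> and \<open>x\<close> is embedded as \<open>(x d0) / d0\<close>.\<close>

definition d0 :: 'a where "d0 = (SOME d. d \<in> D)"

lemma d0: "d0 \<in> D"
  unfolding d0_def using D_nonempty by (simp add: some_in_eq)

definition frac_ring :: "'a fraction ring" where
  "frac_ring = \<lparr>carrier = {frac a d | a d. d \<in> D}, monoid.mult = frac_mult, one = frac d0 d0,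
    zero = frac 0 d0, add = frac_add\<rparr>"

definition embed :: "'a \<Rightarrow> 'a fraction" where
  "embed x = frac (x \<cdot> d0) d0"

lemma frac_ring_simps [simp]:
  "X \<otimes>\<^bsub>frac_ring\<^esub> Y = frac_mult X Y" "X \<oplus>\<^bsub>frac_ring\<^esub> Y = frac_add X Y"
  by (simp_all add: frac_ring_def)

lemma one_frac_ring: "d \<in> D \<Longrightarrow> \<one>\<^bsub>frac_ring\<^esub> = frac d d"
  using d0 by (simp add: frac_ring_def frac_eq_iff D_central)

lemma zero_frac_ring: "d \<in> D \<Longrightarrow> \<zero>\<^bsub>frac_ring\<^esub> = frac 0 d"
  using d0 by (simp add: frac_ring_def frac_eq_iff)

lemma frac_closed [simp]: "d \<in> D \<Longrightarrow> frac a d \<in> carrier frac_ring"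
  by (auto simp: frac_ring_def)

lemma frac_cases:
  assumes "X \<in> carrier frac_ring"
  obtains a d where "d \<in> D" "X = frac a d"
  using assms by (auto simp: frac_ring_def)

lemma common_denominator:
  assumes "X \<in> carrier frac_ring" "Y \<in> carrier frac_ring"
  obtains a b d where "d \<in> D" "X = frac a d" "Y = frac b d"
proof -
  obtain a d b e where X: "d \<in> D" "X = frac a d" and Y: "e \<in> D" "Y = frac b e"
    using assms frac_cases by metis
  have "X = frac (a \<cdot> e) (d \<cdot> e)" "Y = frac (b \<cdot> d) (d \<cdot> e)"
    using X Y frac_expand[of d e a] frac_expand[of e d b] D_central[of d e] by simp_all
  then show thesis using that D_mult X(1) Y(1) by blast
qed

lemma common_denominator3:
  assumes "X \<in> carrier frac_ring" "Y \<in> carrier frac_ring" "Z \<in> carrier frac_ring"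
  obtains a b c d where "d \<in> D" "X = frac a d" "Y = frac b d" "Z = frac c d"
proof -
  obtain a b d where X: "d \<in> D" "X = frac a d" "Y = frac b d"
    using common_denominator[OF assms(1,2)] by metis
  obtain c e where Z: "e \<in> D" "Z = frac c e"
    using frac_cases[OF assms(3)] by metis
  have "X = frac (a \<cdot> e) (d \<cdot> e)" "Y = frac (b \<cdot> e) (d \<cdot> e)" "Z = frac (c \<cdot> d) (d \<cdot> e)"
    using X Z frac_expand[of d e a] frac_expand[of d e b] frac_expand[of e d c] D_central[of d e]
    by simp_all
  then show thesis using that D_mult X(1) Z(1) by blast
qed

lemma ring_frac_ring: "ring frac_ring"
proof (rule ringI)
  show "abelian_group frac_ring"
  proof (rule abelian_groupI)
    fix X Y Z assume X: "X \<in> carrier frac_ring" and Y: "Y \<in> carrier frac_ring"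
    show "X \<oplus>\<^bsub>frac_ring\<^esub> Y \<in> carrier frac_ring" "X \<oplus>\<^bsub>frac_ring\<^esub> Y = Y \<oplus>\<^bsub>frac_ring\<^esub> X"
      by (rule common_denominator[OF X Y]; simp add: frac_add add.commute)+
    assume Z: "Z \<in> carrier frac_ring"
    show "X \<oplus>\<^bsub>frac_ring\<^esub> Y \<oplus>\<^bsub>frac_ring\<^esub> Z = X \<oplus>\<^bsub>frac_ring\<^esub> (Y \<oplus>\<^bsub>frac_ring\<^esub> Z)"
      by (rule common_denominator3[OF X Y Z]) (simp add: frac_add add.assoc)
  next
    fix X assume "X \<in> carrier frac_ring"
    then obtain a d where X: "d \<in> D" "X = frac a d" by (rule frac_cases)
    show "\<zero>\<^bsub>frac_ring\<^esub> \<oplus>\<^bsub>frac_ring\<^esub> X = X"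
      using X by (simp add: zero_frac_ring[of d] frac_add)
    show "\<exists>Y\<in>carrier frac_ring. Y \<oplus>\<^bsub>frac_ring\<^esub> X = \<zero>\<^bsub>frac_ring\<^esub>"
      using X by (intro bexI[of _ "frac (- a) d"]) (simp_all add: zero_frac_ring[of d] frac_add)
  qed (simp add: zero_frac_ring[OF d0] d0)
  show "monoid frac_ring"
  proof (rule monoidI)
    fix X Y Z assume X: "X \<in> carrier frac_ring" and Y: "Y \<in> carrier frac_ring"
    show "X \<otimes>\<^bsub>frac_ring\<^esub> Y \<in> carrier frac_ring"
      by (rule common_denominator[OF X Y]) (simp add: frac_mult D_mult)
    assume Z: "Z \<in> carrier frac_ring"
    show "X \<otimes>\<^bsub>frac_ring\<^esub> Y \<otimes>\<^bsub>frac_ring\<^esub> Z = X \<otimes>\<^bsub>frac_ring\<^esub> (Y \<otimes>\<^bsub>frac_ring\<^esub> Z)"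
      by (rule common_denominator3[OF X Y Z]) (simp add: frac_mult D_mult assoc)
  next
    fix X assume "X \<in> carrier frac_ring"
    then obtain a d where X: "d \<in> D" "X = frac a d" by (rule frac_cases)
    show "\<one>\<^bsub>frac_ring\<^esub> \<otimes>\<^bsub>frac_ring\<^esub> X = X" "X \<otimes>\<^bsub>frac_ring\<^esub> \<one>\<^bsub>frac_ring\<^esub> = X"
      using X by (simp_all add: one_frac_ring[of d] frac_mult frac_expand D_central)
  qed (simp add: one_frac_ring[OF d0] d0)
  fix X Y Z
  assume X: "X \<in> carrier frac_ring" and Y: "Y \<in> carrier frac_ring" and Z: "Z \<in> carrier frac_ring"
  show "(X \<oplus>\<^bsub>frac_ring\<^esub> Y) \<otimes>\<^bsub>frac_ring\<^esub> Z =
      X \<otimes>\<^bsub>frac_ring\<^esub> Z \<oplus>\<^bsub>frac_ring\<^esub> Y \<otimes>\<^bsub>frac_ring\<^esub> Z"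
    by (rule common_denominator3[OF X Y Z]) (simp add: frac_mult frac_add D_mult add_mul)
  show "Z \<otimes>\<^bsub>frac_ring\<^esub> (X \<oplus>\<^bsub>frac_ring\<^esub> Y) =
      Z \<otimes>\<^bsub>frac_ring\<^esub> X \<oplus>\<^bsub>frac_ring\<^esub> Z \<otimes>\<^bsub>frac_ring\<^esub> Y"
    by (rule common_denominator3[OF X Y Z]) (simp add: frac_mult frac_add D_mult mul_add)
qed

lemma embed_eq_iff: "embed x = embed y \<longleftrightarrow> x = y"
  by (simp add: embed_def frac_eq_iff D_cancel d0)

lemma embed_add: "embed (x + y) = frac_add (embed x) (embed y)"
  by (simp add: embed_def frac_add d0 add_mul)

lemma embed_mult: "embed (x \<cdot> y) = frac_mult (embed x) (embed y)"
  using D_right_commute[OF d0, of x "y \<cdot> (d0 \<cdot> d0)"] D_mult[OF d0 d0]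
  by (simp add: embed_def frac_mult frac_eq_iff d0 D_mult) (simp add: assoc)

lemma embed_closed: "embed x \<in> carrier frac_ring"
  by (simp add: embed_def d0)

lemma embed_mult_frac: "d \<in> D \<Longrightarrow> frac_mult (embed x) (frac a d) = frac (x \<cdot> a) d"
  using D_right_commute[OF d0, of x a] D_mult[OF d0]
  by (simp add: embed_def frac_mult frac_eq_iff d0) (simp add: assoc)

lemma frac_mult_embed: "d \<in> D \<Longrightarrow> frac_mult (frac a d) (embed x) = frac (a \<cdot> x) d"
  using D_mult[OF _ d0] D_central[OF d0, of d]
  by (simp add: embed_def frac_mult frac_eq_iff d0) (simp add: assoc)

text \<open>To invert \<open>x\<close> it suffices that a multiple \<open>x \<cdot> c\<close> is a
  denominator: the inverse is \<open>c / (x c)\<close>.\<close>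

lemma inv_embed:
  assumes "x \<cdot> c \<in> D" "c \<cdot> x = x \<cdot> c"
  shows "embed x \<in> Units frac_ring" "inv\<^bsub>frac_ring\<^esub> (embed x) = frac c (x \<cdot> c)"
proof -
  interpret ring frac_ring by (rule ring_frac_ring)
  have 1: "embed x \<otimes>\<^bsub>frac_ring\<^esub> frac c (x \<cdot> c) = \<one>\<^bsub>frac_ring\<^esub>"
      "frac c (x \<cdot> c) \<otimes>\<^bsub>frac_ring\<^esub> embed x = \<one>\<^bsub>frac_ring\<^esub>"
    using assms by (simp_all add: embed_mult_frac frac_mult_embed one_frac_ring)
  show "embed x \<in> Units frac_ring"
    using 1 assms by (auto simp: Units_def embed_closed intro!: bexI[of _ "frac c (x \<cdot> c)"])
  show "inv\<^bsub>frac_ring\<^esub> (embed x) = frac c (x \<cdot> c)"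
    using 1 assms by (intro inv_char) (simp_all add: embed_closed)
qed

end

section \<open>Transfer between an algebra and its ring of fractions\<close>

lemma semigroup_algebra_simps [simp]:
  "carrier semigroup_algebra = UNIV" "x \<otimes>\<^bsub>semigroup_algebra\<^esub> y = convolution x y"
  "x \<oplus>\<^bsub>semigroup_algebra\<^esub> y = x + y" "\<zero>\<^bsub>semigroup_algebra\<^esub> = 0"
  by (simp_all add: semigroup_algebra_def)

lemma ring_center_semigroup_algebra:
  "z \<in> ring_center semigroup_algebra \<longleftrightarrow> (\<forall>r. convolution z r = convolution r z)"
  by (simp add: ring_center_def)

lemma non_zero_divisors_semigroup_algebra:
  "b \<in> non_zero_divisors semigroup_algebra \<longleftrightarrow>
    (\<forall>x. (convolution b x = 0 \<longrightarrow> x = 0) \<and> (convolution x b = 0 \<longrightarrow> x = 0))"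
  by (simp add: non_zero_divisors_def)

text \<open>The isomorphism of the semigroup algebra onto \<open>augmentation\<close>.\<close>

definition lift :: "('s::semigroup_mult \<Rightarrow>\<^sub>0 'f::field) \<Rightarrow> ('s, 'f) unital_algebra" where
  "lift f = (\<Sum>s\<in>Poly_Mapping.keys f. scale (Poly_Mapping.lookup f s) (gen s))"

lemma coeff_lift [simp]: "coeff (lift f) s = Poly_Mapping.lookup f s"
  by (simp add: lift_def lookup_sum if_distrib in_keys_iff cong: if_cong)

lemma lift_in_augmentation [simp]: "lift f \<in> augmentation"
  unfolding lift_def using subspace_augmentation
  by (intro unital_algebra.subspace_sum unital_algebra.subspace_scale) auto

lemma lift_eqI: "x \<in> augmentation \<Longrightarrow> (\<And>s. Poly_Mapping.lookup f s = coeff x s) \<Longrightarrow> lift f = x"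
  by (rule augmentation_eqI) simp_all

lemma lift_eq_iff [simp]: "lift f = lift g \<longleftrightarrow> f = g"
  by (metis coeff_lift poly_mapping_eqI)

lemma lift_add: "lift (f + g) = lift f + lift g"
  using subspace_augmentation
  by (intro lift_eqI unital_algebra.subspace_add) (simp_all add: lookup_add)

lemma lift_zero [simp]: "lift 0 = 0"
  by (simp add: lift_def)

lemma lift_eq_0_iff [simp]: "lift f = 0 \<longleftrightarrow> f = 0"
  using lift_eq_iff[of f 0] by (simp del: lift_eq_iff)

lemma lift_sum: "lift (\<Sum>i\<in>I. f i) = (\<Sum>i\<in>I. lift (f i))"
  by (induction I rule: infinite_finite_induct) (simp_all add: lift_add)

lemma lift_single: "lift (Poly_Mapping.single s a) = scale a (gen s)"
  using subspace_augmentation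
  by (intro lift_eqI unital_algebra.subspace_scale) (auto simp: lookup_single)

lemma lift_convolution: "lift (convolution f g) = lift f * lift g"
  unfolding convolution_def lift_sum lift_single gen_mult
  by (simp add: lift_def sum_product mult.commute)

lemma lift_surj:
  assumes "x \<in> augmentation"
  obtains f where "x = lift f"
proof
  show "x = lift (\<Sum>s\<in>supp x. Poly_Mapping.single s (coeff x s))"
    unfolding lift_sum lift_single using assms by (rule augmentation_expand)
qed

text \<open>The ring \<open>Q\<close> is either a ring of fractions of the semigroup algebra, with \<open>J\<close> all of it,
  or the semigroup algebra with an adjoined identity, with \<open>J\<close> the original semigroup algebra.\<close>

lemma ex_annihilates_commutators_convolution:
  fixes Q (structure) and \<iota> :: "('s::semigroup_mult \<Rightarrow>\<^sub>0 'f::field) \<Rightarrow> 'q"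
    and A :: "('s \<Rightarrow>\<^sub>0 'f) set"
  defines "Z \<equiv> {z \<in> carrier Q. \<forall>r. z \<otimes> \<iota> r = \<iota> r \<otimes> z}"
  assumes "ring Q" and \<iota>: "\<And>r. \<iota> r \<in> J" "inj \<iota>" "\<iota> 0 = \<zero>"
    "\<And>r r'. \<iota> (convolution r r') = \<iota> r \<otimes> \<iota> r'"
    and J: "J \<subseteq> carrier Q" "\<And>q z. q \<in> J \<Longrightarrow> z \<in> Z \<Longrightarrow> q \<otimes> z \<in> J"
    and central_multiple: "\<And>q. q \<in> J \<Longrightarrow> q \<noteq> \<zero> \<Longrightarrow> \<exists>x\<in>Z. q \<otimes> x \<in> Z \<and> q \<otimes> x \<noteq> \<zero>"
    and denominator:
      "\<And>x. x \<in> Z \<Longrightarrow> \<exists>e c. x \<otimes> \<iota> e = \<iota> c \<and> (\<forall>q\<in>J. q \<otimes> \<iota> e = \<zero> \<longrightarrow> q = \<zero>)"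
    and A: "finite A" "\<not> A \<subseteq> {0}"
  shows "\<exists>c. (\<exists>a\<in>A. convolution a c \<noteq> 0) \<and> (\<forall>a\<in>A. \<forall>r.
    convolution a (convolution r c) = convolution r (convolution a c) \<and>
    (\<forall>r'. convolution a (convolution r (convolution r' c)) =
      convolution r (convolution a (convolution r' c))))"
proof -
  interpret ring Q by fact
  have \<iota>_closed [simp, intro]: "\<iota> r \<in> carrier Q" for r
    using \<iota>(1) J(1) by blast
  have Z_closed: "z \<in> carrier Q" if "z \<in> Z" for z
    using that by (simp add: Z_def)
  have Z_comm: "z \<otimes> \<iota> r = \<iota> r \<otimes> z" if "z \<in> Z" for z r
    using that by (simp add: Z_def)
  have Z_mult: "x \<otimes> y \<in> Z" if x: "x \<in> Z" and y: "y \<in> Z" for x y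
  proof -
    have "x \<otimes> y \<otimes> \<iota> r = x \<otimes> (\<iota> r \<otimes> y)" for r
      using x y by (simp add: m_assoc Z_closed Z_comm)
    also have "\<dots> r = \<iota> r \<otimes> (x \<otimes> y)" for r
      using x y Z_comm[OF x] by (simp add: Z_closed flip: m_assoc)
    finally show ?thesis using x y by (simp add: Z_def)
  qed
  \<comment> \<open>A multiplier for all of \<open>A\<close> is built one element at a time. If the
    new product is not central it is nonzero, and a further central factor makes it central and
    nonzero while earlier products stay central.\<close>
  have "\<exists>y\<in>Z. (\<exists>a\<in>A. \<iota> a \<otimes> y \<noteq> \<zero>) \<and> (\<forall>a\<in>A. \<iota> a \<otimes> y \<in> Z)"
    using A
  proof (induction A rule: finite_induct)
    case (insert a A)
    have zero_Z: "\<zero> \<in> Z" by (simp add: Z_def)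
    show ?case
    proof (cases "A \<subseteq> {0}")
      case True
      then have "\<iota> a \<noteq> \<zero>"
        using insert.prems \<iota>(2,3) by (metis injD insert_subset singletonI)
      then obtain x where x: "x \<in> Z" "\<iota> a \<otimes> x \<in> Z" "\<iota> a \<otimes> x \<noteq> \<zero>"
        using central_multiple[OF \<iota>(1)] by blast
      have "\<iota> a' \<otimes> x \<in> Z" if "a' \<in> A" for a'
        using that True \<iota>(3) x(1) zero_Z by (auto simp: Z_closed)
      with x show ?thesis by (intro bexI[of _ x]) auto
    next
      case False
      then obtain y b where y: "y \<in> Z" "b \<in> A" "\<iota> b \<otimes> y \<noteq> \<zero>" "\<forall>a\<in>A. \<iota> a \<otimes> y \<in> Z"
        using insert.IH by blast
      show ?thesis
      proof (cases "\<iota> a \<otimes> y \<in> Z")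
        case True
        with y show ?thesis by (intro bexI[of _ y]) auto
      next
        case False
        then have "\<iota> a \<otimes> y \<noteq> \<zero>" using zero_Z by auto
        then obtain x where x: "x \<in> Z" "\<iota> a \<otimes> y \<otimes> x \<in> Z" "\<iota> a \<otimes> y \<otimes> x \<noteq> \<zero>"
          using central_multiple[OF J(2)[OF \<iota>(1) y(1)]] by blast
        have "\<iota> a' \<otimes> (y \<otimes> x) = \<iota> a' \<otimes> y \<otimes> x" for a'
          using x(1) y(1) by (simp add: m_assoc Z_closed)
        with x y show ?thesis
          by (intro bexI[of _ "y \<otimes> x"]) (auto intro: Z_mult)
      qed
    qed
  qed simp
  then obtain y a0 where y: "y \<in> Z" "a0 \<in> A" "\<iota> a0 \<otimes> y \<noteq> \<zero>" "\<And>a. a \<in> A \<Longrightarrow> \<iota> a \<otimes> y \<in> Z"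
    by blast
  \<comment> \<open>\<open>c\<close> is a numerator of \<open>y\<close>; its denominator
    \<open>e\<close> can be cancelled on the right within \<open>J\<close>.\<close>
  obtain e c where c: "y \<otimes> \<iota> e = \<iota> c" and e: "\<And>q. q \<in> J \<Longrightarrow> q \<otimes> \<iota> e = \<zero> \<Longrightarrow> q = \<zero>"
    using denominator[OF y(1)] by blast
  have y_closed [simp]: "y \<in> carrier Q" using y(1) by (rule Z_closed)
  \<comment> \<open>Both \<open>y\<close> and \<open>\<iota> a \<otimes> y\<close> commute with
    \<open>\<iota> r\<close>, so the commutator of \<open>\<iota> a\<close> and
    \<open>\<iota> r\<close> kills \<open>y\<close>.\<close>
  have shift: "\<iota> a \<otimes> (\<iota> r \<otimes> (y \<otimes> q)) = \<iota> r \<otimes> (\<iota> a \<otimes> (y \<otimes> q))"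
    if "a \<in> A" and q: "q \<in> carrier Q" for a r q
  proof -
    have "\<iota> a \<otimes> (\<iota> r \<otimes> (y \<otimes> q)) = \<iota> a \<otimes> y \<otimes> \<iota> r \<otimes> q"
      using q Z_comm[OF y(1), of r] by (simp add: m_assoc)
    also have "\<dots> = \<iota> r \<otimes> (\<iota> a \<otimes> (y \<otimes> q))"
      using q Z_comm[OF y(4)[OF \<open>a \<in> A\<close>], of r] by (simp add: m_assoc)
    finally show ?thesis .
  qed
  have "convolution a0 c \<noteq> 0"
  proof
    assume "convolution a0 c = 0"
    then have "\<iota> a0 \<otimes> y \<otimes> \<iota> e = \<zero>"
      using \<iota>(3) \<iota>(4)[of a0 c] by (simp add: m_assoc c)
    then show False using e J(2)[OF \<iota>(1) y(1)] y(3) by blast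
  qed
  moreover have "convolution a (convolution r c) = convolution r (convolution a c)"
    if "a \<in> A" for a r
  proof (rule injD[OF \<iota>(2)])
    show "\<iota> (convolution a (convolution r c)) = \<iota> (convolution r (convolution a c))"
      using shift[OF that, of "\<iota> e" r] by (simp add: \<iota>(4) c)
  qed
  moreover have "convolution a (convolution r (convolution r' c)) =
      convolution r (convolution a (convolution r' c))" if "a \<in> A" for a r r'
  proof (rule injD[OF \<iota>(2)])
    have "\<iota> r' \<otimes> \<iota> c = y \<otimes> (\<iota> r' \<otimes> \<iota> e)"
      using Z_comm[OF y(1), of r'] by (simp flip: c m_assoc)
    then show "\<iota> (convolution a (convolution r (convolution r' c))) =
        \<iota> (convolution r (convolution a (convolution r' c)))"
      using shift[OF that, of "\<iota> r' \<otimes> \<iota> e" r] by (simp add: \<iota>(4))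
  qed
  ultimately show ?thesis using y(2) by blast
qed

text \<open>An element \<open>r'\<close> of the unital algebra is a scalar plus an element of the
  semigroup algebra; the two assumed identities treat the two summands.\<close>

lemma (in cancellative_semigroup) cancellative_semigroup_algebraI:
  assumes "\<And>A :: ('s \<Rightarrow>\<^sub>0 'f::field) set. finite A \<Longrightarrow> \<not> A \<subseteq> {0} \<Longrightarrow>
    \<exists>c. (\<exists>a\<in>A. convolution a c \<noteq> 0) \<and> (\<forall>a\<in>A. \<forall>r.
      convolution a (convolution r c) = convolution r (convolution a c) \<and>
      (\<forall>r'. convolution a (convolution r (convolution r' c)) =
        convolution r (convolution a (convolution r' c))))"
  shows "cancellative_semigroup_algebra TYPE('f) TYPE('s)"
proof unfold_locales
  fix A :: "('s, 'f) unital_algebra set"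
  assume A: "finite A" "A \<subseteq> augmentation" "\<not> A \<subseteq> {0}"
  define B where "B = lift -` A"
  have "A \<subseteq> range lift"
    using A(2) lift_surj by blast
  then have A_B: "A = lift ` B" by (auto simp: B_def)
  have "finite B"
    unfolding B_def using A(1) by (intro finite_vimageI) (auto simp: inj_def)
  moreover have "\<not> B \<subseteq> {0}" using A(3) A_B by auto
  ultimately obtain c where c: "\<exists>a\<in>B. convolution a c \<noteq> 0"
    and comm: "\<And>a r. a \<in> B \<Longrightarrow> convolution a (convolution r c) = convolution r (convolution a c)"
      "\<And>a r r'. a \<in> B \<Longrightarrow> convolution a (convolution r (convolution r' c)) =
        convolution r (convolution a (convolution r' c))"
    using assms by meson
  have "annihilates_commutators A (lift c)"
    unfolding annihilates_commutators_def
  proof (intro ballI allI)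
    fix a r r' :: "('s, 'f) unital_algebra" assume "a \<in> A" "r \<in> augmentation"
    then obtain a' r1 where a': "a' \<in> B" "a = lift a'" and r1: "r = lift r1"
      using A_B lift_surj by blast
    define k where "k = Poly_Mapping.lookup r' One"
    have "r' - scale k 1 \<in> augmentation"
      by (simp add: augmentation_def k_def lookup_minus lookup_one zero_unitization_def)
    then obtain r2 where "r' - scale k 1 = lift r2" by (rule lift_surj)
    then have r': "r' = scale k 1 + lift r2" by (simp add: algebra_simps)
    have "a * (r * lift c) = r * (a * lift c)"
      using comm(1)[OF a'(1), of r1] by (simp add: a'(2) r1 flip: lift_convolution)
    moreover have "a * (r * (lift r2 * lift c)) = r * (a * (lift r2 * lift c))"
      using comm(2)[OF a'(1), of r1 r2] by (simp add: a'(2) r1 flip: lift_convolution)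
    ultimately show "(a * r - r * a) * r' * lift c = 0"
      by (simp add: r' algebra_simps)
  qed
  moreover have "\<exists>a\<in>A. a * lift c \<noteq> 0"
    using c by (auto simp: A_B simp flip: lift_convolution)
  ultimately show "\<exists>c\<in>augmentation. annihilates_commutators A c \<and> (\<exists>a\<in>A. a * c \<noteq> 0)"
    by (intro bexI[of _ "lift c"]) auto
qed

lemma centrally_essentialE:
  assumes "centrally_essential R" "a \<in> carrier R" "a \<notin> ring_center R"
  obtains x where "x \<in> ring_center R" "x \<noteq> \<zero>\<^bsub>R\<^esub>"
    "a \<otimes>\<^bsub>R\<^esub> x \<in> ring_center R" "a \<otimes>\<^bsub>R\<^esub> x \<noteq> \<zero>\<^bsub>R\<^esub>"
proof -
  have "\<not> (\<forall>a\<in>carrier R. \<forall>b\<in>carrier R. a \<otimes>\<^bsub>R\<^esub> b = b \<otimes>\<^bsub>R\<^esub> a)"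
    using assms(2,3) by (auto simp: ring_center_def)
  then show thesis
    using assms that unfolding centrally_essential_def by blast
qed

lemma centrally_essentialI:
  assumes "\<And>a. a \<in> carrier R \<Longrightarrow> a \<notin> ring_center R \<Longrightarrow>
    \<exists>x\<in>ring_center R. x \<noteq> \<zero>\<^bsub>R\<^esub> \<and> a \<otimes>\<^bsub>R\<^esub> x \<in> ring_center R \<and> a \<otimes>\<^bsub>R\<^esub> x \<noteq> \<zero>\<^bsub>R\<^esub>"
  shows "centrally_essential R"
  using assms unfolding centrally_essential_def by blast

lemma non_zero_divisor_cancel:
  assumes "b \<in> non_zero_divisors semigroup_algebra"
  shows "convolution b x = 0 \<longleftrightarrow> x = 0" "convolution x b = 0 \<longleftrightarrow> x = 0"
  using assms unfolding non_zero_divisors_semigroup_algebra by (metis convolution_zero)+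

lemma convolution_in_center:
  assumes "x \<in> ring_center semigroup_algebra" "y \<in> ring_center semigroup_algebra"
  shows "convolution x y \<in> ring_center semigroup_algebra"
  unfolding ring_center_semigroup_algebra
proof
  fix r
  have "convolution (convolution x y) r = convolution (convolution x r) y"
    using assms(2) by (simp add: ring_center_semigroup_algebra convolution_assoc)
  also have "\<dots> = convolution r (convolution x y)"
    using assms(1) by (simp add: ring_center_semigroup_algebra convolution_assoc)
  finally show "convolution (convolution x y) r = convolution r (convolution x y)" .
qed

section \<open>Annihilated commutators in a centrally essential semigroup algebra\<close>

context cancellative_semigroup
begin

lemma single_non_zero_divisor:
  "Poly_Mapping.single (s::'s) 1 \<in> non_zero_divisors
    (semigroup_algebra :: ('s \<Rightarrow>\<^sub>0 'f::field) ring)"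
  unfolding non_zero_divisors_semigroup_algebra
proof (intro allI conjI impI)
  fix x :: "'s \<Rightarrow>\<^sub>0 'f"
  assume "convolution (Poly_Mapping.single s 1) x = 0"
  then have "lift (convolution (Poly_Mapping.single s 1) x) = 0" by simp
  then show "x = 0"
    by (simp only: lift_convolution lift_single unital_algebra.scale_one
        gen_mult_eq_0[OF lift_in_augmentation] lift_eq_0_iff)
next
  fix x :: "'s \<Rightarrow>\<^sub>0 'f"
  assume "convolution x (Poly_Mapping.single s 1) = 0"
  then have "lift (convolution x (Poly_Mapping.single s 1)) = 0" by simp
  then show "x = 0"
    by (simp only: lift_convolution lift_single unital_algebra.scale_one
        gen_mult_eq_0[OF lift_in_augmentation] lift_eq_0_iff)
qed

lemma centrally_essential_imp_cancellative_semigroup_algebra: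
  assumes "centrally_essential (semigroup_algebra :: ('s \<Rightarrow>\<^sub>0 'f::field) ring)"
  shows "cancellative_semigroup_algebra TYPE('f) TYPE('s)"
proof (rule cancellative_semigroup_algebraI)
  fix A :: "('s \<Rightarrow>\<^sub>0 'f) set"
  assume A: "finite A" "\<not> A \<subseteq> {0}"
  define Q :: "('s, 'f) unital_algebra ring" where
    "Q = \<lparr>carrier = UNIV, monoid.mult = (*), one = 1, zero = 0, add = (+)\<rparr>"
  have Q_simps [simp]: "carrier Q = UNIV" "x \<otimes>\<^bsub>Q\<^esub> y = x * y" "\<zero>\<^bsub>Q\<^esub> = 0" for x y
    by (simp_all add: Q_def)
  have "ring Q"
    by (intro ringI abelian_groupI monoidI)
      (auto simp: Q_def algebra_simps intro: exI[of _ "- _"])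
  let ?R = "semigroup_algebra :: ('s \<Rightarrow>\<^sub>0 'f) ring"
  let ?Z = "{z \<in> carrier Q. \<forall>r :: 's \<Rightarrow>\<^sub>0 'f. z \<otimes>\<^bsub>Q\<^esub> lift r = lift r \<otimes>\<^bsub>Q\<^esub> z}"
  have lift_center: "lift z \<in> ?Z" if "z \<in> ring_center ?R" for z
    using that by (simp add: ring_center_semigroup_algebra flip: lift_convolution)
  show "\<exists>c. (\<exists>a\<in>A. convolution a c \<noteq> 0) \<and> (\<forall>a\<in>A. \<forall>r.
      convolution a (convolution r c) = convolution r (convolution a c) \<and>
      (\<forall>r'. convolution a (convolution r (convolution r' c)) =
        convolution r (convolution a (convolution r' c))))"
  proof (rule ex_annihilates_commutators_convolution[OF \<open>ring Q\<close>, of lift augmentation])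
    fix q :: "('s, 'f) unital_algebra" assume "q \<in> augmentation" "q \<noteq> \<zero>\<^bsub>Q\<^esub>"
    then obtain f where f: "q = lift f" "f \<noteq> 0" using lift_surj by force
    show "\<exists>x\<in>?Z. q \<otimes>\<^bsub>Q\<^esub> x \<in> ?Z \<and> q \<otimes>\<^bsub>Q\<^esub> x \<noteq> \<zero>\<^bsub>Q\<^esub>"
    proof (cases "f \<in> ring_center ?R")
      case True
      then show ?thesis
        \<comment> \<open>A central element needs no proper multiplier, and the unital algebra
          provides \<open>1\<close>.\<close>
        using lift_center f by (intro bexI[of _ 1]) auto
    next
      case False
      then obtain x where x: "x \<in> ring_center ?R" "convolution f x \<in> ring_center ?R"
          "convolution f x \<noteq> 0"
        using centrally_essentialE[OF assms, of f] by auto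
      have "q * lift x = lift (convolution f x)" by (simp add: f lift_convolution)
      then show ?thesis
        using lift_center[OF x(1)] lift_center[OF x(2)] x(3) by (intro bexI[of _ "lift x"]) auto
    qed
  next
    fix x assume "x \<in> ?Z"
    \<comment> \<open>Any semigroup element serves as a denominator: it moves \<open>x\<close> into
      the ideal \<open>augmentation\<close> and is cancellable there.\<close>
    let ?e = "Poly_Mapping.single undefined 1 :: 's \<Rightarrow>\<^sub>0 'f"
    have "x * lift ?e \<in> augmentation"
      by (intro augmentation_mult) simp
    then obtain c where "x * lift ?e = lift c" by (rule lift_surj)
    moreover have "q = 0" if "q \<in> augmentation" "q * lift ?e = 0" for q :: "('s, 'f) unital_algebra"
      using that gen_mult_eq_0(2)[of q undefined] by (simp add: lift_single)
    ultimately show "\<exists>e c. x \<otimes>\<^bsub>Q\<^esub> lift e = lift c \<and>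
        (\<forall>q\<in>augmentation. q \<otimes>\<^bsub>Q\<^esub> lift e = \<zero>\<^bsub>Q\<^esub> \<longrightarrow> q = \<zero>\<^bsub>Q\<^esub>)"
      by (intro exI[of _ ?e] exI[of _ c]) simp
  qed (use A in \<open>auto simp: inj_def lift_convolution augmentation_mult\<close>)
qed

end

section \<open>The ring of fractions with central regular denominators\<close>

context cancellative_semigroup_algebra
begin

definition central_regulars :: "('s \<Rightarrow>\<^sub>0 'f) set" where
  "central_regulars = ring_center semigroup_algebra \<inter> non_zero_divisors semigroup_algebra"

lemma non_zero_divisor_divides_central_regular:
  assumes "b \<in> non_zero_divisors (semigroup_algebra :: ('s \<Rightarrow>\<^sub>0 'f) ring)"
  obtains c where "convolution b c \<in> central_regulars" "convolution c b = convolution b c"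
proof -
  have "x = 0" if "x \<in> augmentation" "lift b * x = 0" for x
  proof -
    obtain y where y: "x = lift y" using lift_surj[OF \<open>x \<in> augmentation\<close>] .
    then have "convolution b y = 0"
      using that(2) by (simp flip: lift_convolution)
    then show ?thesis
      by (simp add: y non_zero_divisor_cancel[OF assms])
  qed
  then have "\<exists>c\<in>augmentation. \<forall>x\<in>augmentation.
      lift b * c * x = x * (lift b * c) \<and> (lift b * c * x = 0 \<longrightarrow> x = 0)"
    by (rule left_regular_divides_central[OF lift_in_augmentation])
  then obtain c where "c \<in> augmentation" and c: "\<forall>x\<in>augmentation.
      lift b * c * x = x * (lift b * c) \<and> (lift b * c * x = 0 \<longrightarrow> x = 0)" ..
  obtain c' where c': "c = lift c'" using lift_surj[OF \<open>c \<in> augmentation\<close>] .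
  have comm: "convolution (convolution b c') x = convolution x (convolution b c')" for x
    using bspec[OF c lift_in_augmentation[of x]] by (simp add: c' flip: lift_convolution)
  have reg: "x = 0" if "convolution (convolution b c') x = 0" for x
  proof -
    have "lift b * c * lift x = 0"
      using that by (simp add: c' flip: lift_convolution)
    then show ?thesis using bspec[OF c lift_in_augmentation[of x]] by simp
  qed
  have "convolution b c' \<in> ring_center semigroup_algebra"
    unfolding ring_center_semigroup_algebra by (intro allI comm)
  moreover have "convolution b c' \<in> non_zero_divisors semigroup_algebra"
    unfolding non_zero_divisors_semigroup_algebra
  proof (intro allI conjI impI)
    show "x = 0" if "convolution (convolution b c') x = 0" for x using reg[OF that] .
    show "x = 0" if "convolution x (convolution b c') = 0" for x
      using that reg[of x] unfolding comm by blast
  qed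
  ultimately have "convolution b c' \<in> central_regulars"
    by (simp add: central_regulars_def)
  \<comment> \<open>\<open>b\<close> commutes with the central product \<open>b c'\<close>;
    cancelling \<open>b\<close> on the left gives \<open>c' b = b c'\<close>.\<close>
  moreover have "convolution b (convolution c' b) = convolution b (convolution b c')"
    using comm[of b] by (simp add: convolution_assoc)
  then have "convolution b (convolution c' b - convolution b c') = 0"
    using convolution_add_right[of b "convolution c' b - convolution b c'" "convolution b c'"]
    by simp
  then have "convolution c' b = convolution b c'"
    by (simp add: non_zero_divisor_cancel[OF assms])
  ultimately show thesis by (rule that)
qed

interpretation fractions: central_denominators convolution central_regulars
proof
  show "central_regulars \<noteq> {}"
    using non_zero_divisor_divides_central_regular[OF single_non_zero_divisor] by blast
  show "convolution d e \<in> central_regulars"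
    if "d \<in> central_regulars" "e \<in> central_regulars" for d e
  proof -
    have "convolution d e \<in> ring_center semigroup_algebra"
      using that by (auto simp: central_regulars_def intro: convolution_in_center)
    moreover have "d \<in> non_zero_divisors semigroup_algebra" "e \<in> non_zero_divisors semigroup_algebra"
      using that by (simp_all add: central_regulars_def)
    note cancel = this[THEN non_zero_divisor_cancel(1)] this[THEN non_zero_divisor_cancel(2)]
    have "convolution d e \<in> non_zero_divisors semigroup_algebra"
      unfolding non_zero_divisors_semigroup_algebra convolution_assoc cancel
      by (simp add: cancel flip: convolution_assoc)
    ultimately show ?thesis
      by (simp add: central_regulars_def)
  qed
  show "convolution d x = convolution x d" if "d \<in> central_regulars" for d x
    using that by (simp add: central_regulars_def ring_center_semigroup_algebra)
  show "x = 0" if "d \<in> central_regulars" "convolution x d = 0" for d x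
    using that non_zero_divisor_cancel(2) by (auto simp: central_regulars_def)
qed (rule convolution_assoc convolution_add_left convolution_add_right)+

lemma has_classical_right_fractions:
  "has_classical_right_fractions (semigroup_algebra :: ('s \<Rightarrow>\<^sub>0 'f) ring)"
  unfolding has_classical_right_fractions_def
proof (intro ballI)
  fix a b :: "'s \<Rightarrow>\<^sub>0 'f" assume "b \<in> non_zero_divisors semigroup_algebra"
  then obtain c where c: "convolution b c \<in> central_regulars"
    by (rule non_zero_divisor_divides_central_regular)
  \<comment> \<open>The common right multiple required by the Ore condition comes from the central
    regular \<open>b c\<close>.\<close>
  then have "convolution b (convolution c a) = convolution a (convolution b c)"
    by (simp add: fractions.D_central flip: convolution_assoc)
  with c show "\<exists>c\<in>carrier semigroup_algebra. \<exists>d\<in>non_zero_divisors semigroup_algebra.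
      b \<otimes>\<^bsub>semigroup_algebra\<^esub> c = a \<otimes>\<^bsub>semigroup_algebra\<^esub> d"
    by (auto simp: central_regulars_def)
qed

lemma is_classical_right_ring_of_fractions:
  "is_classical_right_ring_of_fractions (semigroup_algebra :: ('s \<Rightarrow>\<^sub>0 'f) ring)
    fractions.frac_ring fractions.embed"
  unfolding is_classical_right_ring_of_fractions_def
proof (intro conjI ballI)
  show "ring fractions.frac_ring" by (rule fractions.ring_frac_ring)
  fix b :: "'s \<Rightarrow>\<^sub>0 'f" assume "b \<in> non_zero_divisors semigroup_algebra"
  then obtain c where "convolution b c \<in> central_regulars" "convolution c b = convolution b c"
    by (rule non_zero_divisor_divides_central_regular)
  then show "fractions.embed b \<in> Units fractions.frac_ring"
    by (rule fractions.inv_embed)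
next
  fix q assume "q \<in> carrier fractions.frac_ring"
  then obtain a d where d: "d \<in> central_regulars" "q = fractions.frac a d"
    by (rule fractions.frac_cases)
  then have "inv\<^bsub>fractions.frac_ring\<^esub> (fractions.embed d) = fractions.frac d (convolution d d)"
    by (intro fractions.inv_embed fractions.D_mult refl)
  then have "q = fractions.embed a \<otimes>\<^bsub>fractions.frac_ring\<^esub> inv\<^bsub>fractions.frac_ring\<^esub> (fractions.embed d)"
    using d by (simp add: fractions.embed_mult_frac fractions.D_mult fractions.frac_expand)
  with d(1) show "\<exists>a\<in>carrier semigroup_algebra. \<exists>b\<in>non_zero_divisors semigroup_algebra.
      q = fractions.embed a \<otimes>\<^bsub>fractions.frac_ring\<^esub> inv\<^bsub>fractions.frac_ring\<^esub> (fractions.embed b)"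
    by (auto simp: central_regulars_def)
qed (auto simp: inj_on_def fractions.embed_closed fractions.embed_eq_iff fractions.embed_add
    fractions.embed_mult)

lemma frac_in_center:
  assumes "z \<in> ring_center semigroup_algebra" "d \<in> central_regulars"
  shows "fractions.frac z d \<in> ring_center fractions.frac_ring"
proof -
  have "fractions.frac_mult (fractions.frac z d) X = fractions.frac_mult X (fractions.frac z d)"
    if X: "X \<in> carrier fractions.frac_ring" for X
  proof -
    obtain a e where e: "e \<in> central_regulars" "X = fractions.frac a e"
      using fractions.frac_cases[OF X] by blast
    have "convolution z a = convolution a z"
      using assms(1) unfolding ring_center_semigroup_algebra ..
    then show ?thesis
      using fractions.D_central[OF e(1), of d] e assms(2) by (simp add: fractions.frac_mult)
  qed
  then show ?thesis
    using assms(2) by (simp add: ring_center_def)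
qed

lemma centrally_essential_fractions:
  assumes "centrally_essential (semigroup_algebra :: ('s \<Rightarrow>\<^sub>0 'f) ring)"
  shows "centrally_essential fractions.frac_ring"
proof (rule centrally_essentialI)
  fix X
  assume X: "X \<in> carrier fractions.frac_ring" "X \<notin> ring_center fractions.frac_ring"
  then obtain a d where d: "d \<in> central_regulars" "X = fractions.frac a d"
    using fractions.frac_cases by blast
  then have "a \<notin> ring_center semigroup_algebra"
    using X(2) frac_in_center by blast
  then obtain x where x: "x \<in> ring_center semigroup_algebra" "x \<noteq> 0"
      "convolution a x \<in> ring_center semigroup_algebra" "convolution a x \<noteq> 0"
    using centrally_essentialE[OF assms, of a] by auto
  have nonzero: "fractions.frac z d \<noteq> \<zero>\<^bsub>fractions.frac_ring\<^esub>" if "z \<noteq> 0" for z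
    using that d(1) fractions.D_regular
    by (auto simp: fractions.zero_frac_ring[OF d(1)] fractions.frac_eq_iff)
  \<comment> \<open>The multiplier for \<open>a / d\<close> is the image \<open>(x d) / d\<close> of
    \<open>x\<close>, with product \<open>(a x) / d\<close>.\<close>
  have "convolution x d \<in> ring_center semigroup_algebra"
    using x(1) d(1) by (auto simp: central_regulars_def intro: convolution_in_center)
  moreover have "convolution x d \<noteq> 0"
    using x(2) fractions.D_regular[OF d(1)] by blast
  moreover have "X \<otimes>\<^bsub>fractions.frac_ring\<^esub> fractions.frac (convolution x d) d =
      fractions.frac (convolution a x) d"
    using d fractions.frac_expand[OF d(1) d(1), of "convolution a x"]
    by (simp add: fractions.frac_mult convolution_assoc)
  ultimately show "\<exists>x\<in>ring_center fractions.frac_ring. x \<noteq> \<zero>\<^bsub>fractions.frac_ring\<^esub> \<and>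
      X \<otimes>\<^bsub>fractions.frac_ring\<^esub> x \<in> ring_center fractions.frac_ring \<and>
      X \<otimes>\<^bsub>fractions.frac_ring\<^esub> x \<noteq> \<zero>\<^bsub>fractions.frac_ring\<^esub>"
    using x(3,4) d(1) nonzero frac_in_center
    by (intro bexI[of _ "fractions.frac (convolution x d) d"]) simp_all
qed

end

section \<open>Descent from the ring of fractions\<close>

lemma centralizer_of_numerators:
  fixes Q (structure)
  assumes fr: "is_classical_right_ring_of_fractions R Q \<iota>"
  shows "{z \<in> carrier Q. \<forall>r\<in>carrier R. z \<otimes> \<iota> r = \<iota> r \<otimes> z} = ring_center Q"
proof -
  interpret ring Q using fr by (simp add: is_classical_right_ring_of_fractions_def)
  have closed: "\<iota> r \<in> carrier Q" if "r \<in> carrier R" for r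
    using fr that by (auto simp: is_classical_right_ring_of_fractions_def)
  have "z \<otimes> q = q \<otimes> z"
    if z: "z \<in> carrier Q" "\<forall>r\<in>carrier R. z \<otimes> \<iota> r = \<iota> r \<otimes> z" and "q \<in> carrier Q" for z q
  proof -
    obtain a b where ab: "a \<in> carrier R" "b \<in> carrier R" "\<iota> b \<in> Units Q"
      "q = \<iota> a \<otimes> inv (\<iota> b)"
      using fr \<open>q \<in> carrier Q\<close>
      unfolding is_classical_right_ring_of_fractions_def non_zero_divisors_def by blast
    \<comment> \<open>Commuting with \<open>\<iota> b\<close> passes to its inverse, hence to every
      fraction.\<close>
    have "inv (\<iota> b) \<otimes> z = inv (\<iota> b) \<otimes> (z \<otimes> \<iota> b) \<otimes> inv (\<iota> b)"
      using z(1) ab closed by (simp add: m_assoc)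
    also have "z \<otimes> \<iota> b = \<iota> b \<otimes> z"
      using z(2) ab(2) by blast
    also have "inv (\<iota> b) \<otimes> (\<iota> b \<otimes> z) \<otimes> inv (\<iota> b) = z \<otimes> inv (\<iota> b)"
      using z(1) ab(2,3) closed by (simp flip: m_assoc)
    finally have "inv (\<iota> b) \<otimes> z = z \<otimes> inv (\<iota> b)" .
    then have "q \<otimes> z = \<iota> a \<otimes> z \<otimes> inv (\<iota> b)"
      using z(1) ab closed by (simp add: m_assoc)
    also have "\<iota> a \<otimes> z = z \<otimes> \<iota> a"
      using z(2) ab(1) by simp
    also have "z \<otimes> \<iota> a \<otimes> inv (\<iota> b) = z \<otimes> q"
      using z(1) ab closed by (simp add: m_assoc)
    finally show ?thesis ..
  qed
  then show ?thesis
    using closed by (auto simp: ring_center_def)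
qed

context cancellative_semigroup
begin

lemma fractions_imp_cancellative_semigroup_algebra:
  fixes Q (structure) and \<iota> :: "('s \<Rightarrow>\<^sub>0 'f::field) \<Rightarrow> 'q"
  assumes fr: "is_classical_right_ring_of_fractions semigroup_algebra Q \<iota>"
    and ce: "centrally_essential Q"
  shows "cancellative_semigroup_algebra TYPE('f) TYPE('s)"
proof (rule cancellative_semigroup_algebraI)
  fix A :: "('s \<Rightarrow>\<^sub>0 'f) set"
  assume A: "finite A" "\<not> A \<subseteq> {0}"
  have "ring Q" and closed: "\<And>r. \<iota> r \<in> carrier Q" and "inj \<iota>"
    and add: "\<And>x y. \<iota> (x + y) = \<iota> x \<oplus> \<iota> y"
    and mult: "\<And>x y. \<iota> (convolution x y) = \<iota> x \<otimes> \<iota> y"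
    using fr by (auto simp: is_classical_right_ring_of_fractions_def)
  interpret ring Q by fact
  have fracs: "\<exists>a b. \<iota> b \<in> Units Q \<and> q = \<iota> a \<otimes> inv (\<iota> b)" if "q \<in> carrier Q" for q
    using fr that unfolding is_classical_right_ring_of_fractions_def by blast
  have "\<iota> 0 \<oplus> \<iota> 0 = \<iota> 0 \<oplus> \<zero>"
    using add[of 0 0] closed[of 0] by simp
  then have zero: "\<iota> 0 = \<zero>"
    using closed by (simp del: r_zero)
  have Z: "{z \<in> carrier Q. \<forall>r. z \<otimes> \<iota> r = \<iota> r \<otimes> z} = ring_center Q"
    using centralizer_of_numerators[OF fr] by simp
  show "\<exists>c. (\<exists>a\<in>A. convolution a c \<noteq> 0) \<and> (\<forall>a\<in>A. \<forall>r.
      convolution a (convolution r c) = convolution r (convolution a c) \<and>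
      (\<forall>r'. convolution a (convolution r (convolution r' c)) =
        convolution r (convolution a (convolution r' c))))"
  proof (rule ex_annihilates_commutators_convolution[OF \<open>ring Q\<close>, of \<iota> "carrier Q"], unfold Z)
    fix q assume q: "q \<in> carrier Q" "q \<noteq> \<zero>"
    show "\<exists>x\<in>ring_center Q. q \<otimes> x \<in> ring_center Q \<and> q \<otimes> x \<noteq> \<zero>"
    proof (cases "q \<in> ring_center Q")
      case True
      with q show ?thesis by (intro bexI[of _ \<one>]) (auto simp: ring_center_def)
    next
      case False
      then show ?thesis
        using centrally_essentialE[OF ce q(1)] by metis
    qed
  next
    fix x assume "x \<in> ring_center Q"
    then have "x \<in> carrier Q" by (simp add: ring_center_def)
    then obtain a b where b: "\<iota> b \<in> Units Q" "x = \<iota> a \<otimes> inv (\<iota> b)"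
      using fracs by blast
    have "x \<otimes> \<iota> b = \<iota> a"
      using b closed by (simp add: m_assoc)
    moreover have "q = \<zero>" if "q \<in> carrier Q" "q \<otimes> \<iota> b = \<zero>" for q
    proof -
      have "q \<otimes> \<iota> b \<otimes> inv (\<iota> b) = q"
        using that(1) b closed by (simp add: m_assoc)
      then show ?thesis using that(2) b(1) by simp
    qed
    ultimately show "\<exists>e c. x \<otimes> \<iota> e = \<iota> c \<and> (\<forall>q\<in>carrier Q. q \<otimes> \<iota> e = \<zero> \<longrightarrow> q = \<zero>)"
      by blast
  next
    fix q z assume "q \<in> carrier Q" "z \<in> ring_center Q"
    then show "q \<otimes> z \<in> carrier Q" by (simp add: ring_center_def)
  qed (use A zero mult closed \<open>inj \<iota>\<close> in auto)
qed

end

text \<open>A central multiplier \<open>x\<close> in \<open>Q\<close> has the form of a numerator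
  \<open>c\<close> times an inverse denominator \<open>b\<close>. Multiplying it by a central
  regular multiple \<open>d\<close> of \<open>b\<close> clears the denominator and keeps it central,
  and the centre of the algebra consists of its elements that are central in
  \<open>Q\<close>.\<close>

lemma (in cancellative_semigroup_algebra) centrally_essential_of_fractions:
  fixes Q (structure) and \<iota> :: "('s \<Rightarrow>\<^sub>0 'f) \<Rightarrow> 'q"
  assumes fr: "is_classical_right_ring_of_fractions semigroup_algebra Q \<iota>"
    and ce: "centrally_essential Q"
  shows "centrally_essential (semigroup_algebra :: ('s \<Rightarrow>\<^sub>0 'f) ring)"
proof (rule centrally_essentialI)
  let ?R = "semigroup_algebra :: ('s \<Rightarrow>\<^sub>0 'f) ring"
  fix a assume "a \<notin> ring_center ?R"
  have "ring Q" and closed: "\<And>r. \<iota> r \<in> carrier Q" and inj: "inj \<iota>"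
    and add: "\<And>x y. \<iota> (x + y) = \<iota> x \<oplus> \<iota> y"
    and mult: "\<And>x y. \<iota> (convolution x y) = \<iota> x \<otimes> \<iota> y"
    and units: "\<And>b. b \<in> non_zero_divisors ?R \<Longrightarrow> \<iota> b \<in> Units Q"
    using fr by (auto simp: is_classical_right_ring_of_fractions_def)
  interpret ring Q by fact
  have "\<iota> 0 \<oplus> \<iota> 0 = \<iota> 0 \<oplus> \<zero>"
    using add[of 0 0] closed[of 0] by simp
  then have zero: "\<iota> 0 = \<zero>"
    using closed by (simp del: r_zero)
  have center: "\<iota> z \<in> ring_center Q \<longleftrightarrow> z \<in> ring_center ?R" for z
  proof -
    have "\<iota> z \<in> ring_center Q \<longleftrightarrow> (\<forall>r. \<iota> (convolution z r) = \<iota> (convolution r z))"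
      using centralizer_of_numerators[OF fr] closed by (auto simp: mult)
    then show ?thesis
      using inj by (simp add: inj_eq ring_center_semigroup_algebra)
  qed
  have center_mult: "x \<otimes> y \<in> ring_center Q" if "x \<in> ring_center Q" "y \<in> ring_center Q" for x y
  proof -
    have xy: "x \<in> carrier Q" "y \<in> carrier Q"
      using that by (simp_all add: ring_center_def)
    have "x \<otimes> y \<otimes> r = r \<otimes> (x \<otimes> y)" if r: "r \<in> carrier Q" for r
    proof -
      have "x \<otimes> y \<otimes> r = x \<otimes> r \<otimes> y"
        using \<open>y \<in> ring_center Q\<close> xy r by (simp add: ring_center_def m_assoc)
      also have "x \<otimes> r = r \<otimes> x"
        using \<open>x \<in> ring_center Q\<close> r by (simp add: ring_center_def)
      finally show ?thesis using xy r by (simp add: m_assoc)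
    qed
    then show ?thesis using xy by (simp add: ring_center_def)
  qed
  obtain x where x: "x \<in> ring_center Q" "x \<noteq> \<zero>" "\<iota> a \<otimes> x \<in> ring_center Q" "\<iota> a \<otimes> x \<noteq> \<zero>"
    using centrally_essentialE[OF ce closed[of a]] center \<open>a \<notin> ring_center ?R\<close> by metis
  then have "x \<in> carrier Q" by (simp add: ring_center_def)
  then obtain c b where b: "b \<in> non_zero_divisors ?R" "x = \<iota> c \<otimes> inv (\<iota> b)"
    using fr unfolding is_classical_right_ring_of_fractions_def by blast
  obtain e where e: "convolution b e \<in> central_regulars"
    using non_zero_divisor_divides_central_regular[OF b(1)] by blast
  \<comment> \<open>The new multiplier is \<open>c e\<close>, the preimage of
    \<open>x \<otimes> \<iota> d\<close>; nothing nonzero is lost because \<open>\<iota> d\<close>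
    is a unit.\<close>
  define d where "d = convolution b e"
  have d: "\<iota> d \<in> Units Q" "\<iota> d \<in> ring_center Q"
    using e units center by (auto simp: d_def central_regulars_def)
  have nonzero: "q \<otimes> \<iota> d \<noteq> \<zero>" if "q \<in> carrier Q" "q \<noteq> \<zero>" for q
  proof
    assume "q \<otimes> \<iota> d = \<zero>"
    moreover have "q \<otimes> \<iota> d \<otimes> inv (\<iota> d) = q"
      using that(1) d(1) closed by (simp add: m_assoc)
    ultimately show False using that(2) d(1) by simp
  qed
  have "x \<otimes> \<iota> d = \<iota> c \<otimes> (inv (\<iota> b) \<otimes> \<iota> b) \<otimes> \<iota> e"
    by (simp only: b(2) d_def mult m_assoc m_closed closed Units_inv_closed units[OF b(1)])
  then have xd: "x \<otimes> \<iota> d = \<iota> (convolution c e)"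
    using units[OF b(1)] closed by (simp add: mult)
  then have axd: "\<iota> (convolution a (convolution c e)) = \<iota> a \<otimes> x \<otimes> \<iota> d"
    using closed \<open>x \<in> carrier Q\<close> by (simp add: mult[of a] m_assoc)
  have "convolution c e \<in> ring_center ?R" "convolution a (convolution c e) \<in> ring_center ?R"
    using center_mult[OF x(1) d(2)] center_mult[OF x(3) d(2)] by (simp_all flip: center xd axd)
  moreover have "\<iota> (convolution c e) \<noteq> \<iota> 0" "\<iota> (convolution a (convolution c e)) \<noteq> \<iota> 0"
    using nonzero[of x] nonzero[of "\<iota> a \<otimes> x"] x(2,4) \<open>x \<in> carrier Q\<close> closed
    by (simp_all add: zero axd flip: xd)
  then have "convolution c e \<noteq> 0" "convolution a (convolution c e) \<noteq> 0"
    by auto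
  ultimately show "\<exists>x\<in>ring_center ?R. x \<noteq> \<zero>\<^bsub>?R\<^esub> \<and>
      a \<otimes>\<^bsub>?R\<^esub> x \<in> ring_center ?R \<and> a \<otimes>\<^bsub>?R\<^esub> x \<noteq> \<zero>\<^bsub>?R\<^esub>"
    by (intro bexI[of _ "convolution c e"]) simp_all
qed

theorem theorem1p2:
  assumes left_cancel: "\<And>a b c :: 's::semigroup_mult. c * a = c * b \<Longrightarrow> a = b"
    and right_cancel: "\<And>a b c :: 's. a * c = b * c \<Longrightarrow> a = b"
  shows "centrally_essential (semigroup_algebra :: ('s \<Rightarrow>\<^sub>0 'f::field) ring) \<longleftrightarrow>
    has_classical_right_fractions (semigroup_algebra :: ('s \<Rightarrow>\<^sub>0 'f) ring) \<and>
    (\<exists>(Q :: ('s \<Rightarrow>\<^sub>0 'f) fraction ring) \<iota>.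
      is_classical_right_ring_of_fractions (semigroup_algebra :: ('s \<Rightarrow>\<^sub>0 'f) ring) Q \<iota> \<and>
      centrally_essential Q)"
proof -
  interpret cancellative_semigroup "TYPE('s)"
    by unfold_locales (fact left_cancel right_cancel)+
  show ?thesis
  proof
    assume ce: "centrally_essential (semigroup_algebra :: ('s \<Rightarrow>\<^sub>0 'f) ring)"
    interpret cancellative_semigroup_algebra "TYPE('s)" "TYPE('f)"
      using ce by (rule centrally_essential_imp_cancellative_semigroup_algebra)
    show "has_classical_right_fractions (semigroup_algebra :: ('s \<Rightarrow>\<^sub>0 'f) ring) \<and>
        (\<exists>(Q :: ('s \<Rightarrow>\<^sub>0 'f) fraction ring) \<iota>.
          is_classical_right_ring_of_fractions (semigroup_algebra :: ('s \<Rightarrow>\<^sub>0 'f) ring) Q \<iota> \<and>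
          centrally_essential Q)"
      using has_classical_right_fractions is_classical_right_ring_of_fractions
        centrally_essential_fractions[OF ce] by blast
  next
    assume "has_classical_right_fractions (semigroup_algebra :: ('s \<Rightarrow>\<^sub>0 'f) ring) \<and>
        (\<exists>(Q :: ('s \<Rightarrow>\<^sub>0 'f) fraction ring) \<iota>.
          is_classical_right_ring_of_fractions (semigroup_algebra :: ('s \<Rightarrow>\<^sub>0 'f) ring) Q \<iota> \<and>
          centrally_essential Q)"
    then obtain Q :: "('s \<Rightarrow>\<^sub>0 'f) fraction ring" and \<iota>
      where Q: "is_classical_right_ring_of_fractions (semigroup_algebra :: ('s \<Rightarrow>\<^sub>0 'f) ring) Q \<iota>"
        "centrally_essential Q"
      by blast
    interpret cancellative_semigroup_algebra "TYPE('s)" "TYPE('f)"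
      using Q by (rule fractions_imp_cancellative_semigroup_algebra)
    show "centrally_essential (semigroup_algebra :: ('s \<Rightarrow>\<^sub>0 'f) ring)"
      using Q by (rule centrally_essential_of_fractions)
  qed
qed

end
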